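(* Let the following assumptions hold: (A1) the sets $P$ and $Q$ are bounded; (A2) $F(\cdot,v)$ is convex for any fixed $v$, $F(u,\cdot)$ is concave for any fixed $u$, $\Phi(\cdot,y)$ is convex for any fixed $y$, and $\Phi(x,\cdot)$ is concave for any fixed $x$. Then the averaged points $$(\hat u_{k+1},\hat v_{k+1},\hat x_{k+1},\hat y_{k+1})=\frac1{k+1}\sum_{i=0}^k(u_i,v_i,x_i,y_i)$$ generated by the method (M1) described in the context satisfy $$\xi(\hat u_{k+1},\hat x_{k+1})-\eta(\hat v_{k+1},\hat y_{k+1})\le\frac{\hat\beta_{k+1}}{k+1}\left(\gamma D+\frac{L^2}{2\gamma}\right),$$ $$\|\tilde x_0+\mathcal{B}\hat u_{k+1}-\hat x_{k+1}\|_{\mu,*}\le\frac{\hat\beta_{k+1}\sqrt{\sigma_\mu}}{r(k+1)}\left(\gamma D+\frac{L^2}{2\gamma}\right),$$ $$\|\tilde y_0+\mathcal{C}\hat v_{k+1}-\hat y_{k+1}\|_{\lambda,*}\le\frac{\hat\beta_{k+1}\sqrt{\sigma_\lambda}}{r(k+1)}\left(\gamma D+\frac{L^2}{2\gamma}\right).$$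
   Context: Differential game: $\dot x=A_x(t)x+B(t)u$, $\dot y=A_y(t)y+C(t)v$, $(x(0),y(0))=(x_0,y_0)$, $t\in[0,\theta]$, $x(t)\in\mathbb{R}^n$, $y(t)\in\mathbb{R}^m$, continuous matrices. Controls: $u(t)\in P\subseteq\mathbb{R}^p$, $v(t)\in Q\subseteq\mathbb{R}^q$, $P,Q$ closed convex. $L^2_p=L^2([0,\theta],\mathbb{R}^p)$, $L^2_q=L^2([0,\theta],\mathbb{R}^q)$; $\mathcal{U}=\{u\in L^2_p:u(t)\in P\ \forall t\}$, $\mathcal{V}=\{v\in L^2_q:v(t)\in Q\ \forall t\}$. The pursuer minimizes and the evader maximizes $F(u,v)+\Phi(x(\theta),y(\theta))$, $F(u,v)=\int_0^\theta\tilde F(\tau,u(\tau),v(\tau))d\tau$. Standing assumptions: a saddle point exists; $F$ is upper semicontinuous in $v$ and lower semicontinuous in $u$; $\Phi$ is continuous. With transition matrices $V_x(t,\tau)$ ($\frac{d}{dt}V_x(t,\tau)=A_x(t)V_x(t,\tau)$, $V_x(\tau,\tau)=I$) and $V_y$ likewise: $\mathcal{B}u=\int_0^\theta V_x(\theta,\tau)B(\tau)u(\tau)d\tau$, $\tilde x_0=V_x(\theta,0)x_0$, $\mathcal{C}v=\int_0^\theta V_y(\theta,\tau)C(\tau)v(\tau)d\tau$, $\tilde y_0=V_y(\theta,0)y_0$, so $x(\theta)=\tilde x_0+\mathcal{B}u$, $y(\theta)=\tilde y_0+\mathcal{C}v$. $X\subset\mathbb{R}^n$, $Y\subset\mathbb{R}^m$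 are closed convex bounded sets containing all reachable $x(\theta)$, $y(\theta)$. The game is $\min_{u\in\mathcal{U},x\in X}[\max_{v\in\mathcal{V},y\in Y}\{F(u,v)+\Phi(x,y):y=\tilde y_0+\mathcal{C}v\}:x=\tilde x_0+\mathcal{B}u]$. Dual variables $\lambda\in\mathbb{R}^m$, $\mu\in\mathbb{R}^n$ with norms $\|\cdot\|_\lambda,\|\cdot\|_\mu$ and dual norms $\|\cdot\|_{\lambda,*},\|\cdot\|_{\mu,*}$. Conjugate problem: $\min_\lambda\max_\mu\psi(\lambda,\mu)$, $\psi=\psi_1+\psi_2-\langle\mu,\tilde x_0\rangle+\langle\lambda,\tilde y_0\rangle$, where $\psi_1(\lambda,\mu)=\min_{u\in\mathcal{U}}\max_{v\in\mathcal{V}}[F(u,v)-\langle\mu,\mathcal{B}u\rangle+\langle\lambda,\mathcal{C}v\rangle]$, $\psi_2(\lambda,\mu)=\min_{x\in X}\max_{y\in Y}[\Phi(x,y)+\langle\mu,x\rangle-\langle\lambda,y\rangle]$, both assumed to be solvable. $(\lambda^*,\mu^* )$ is a saddle point of the conjugate problem (one exists). $(u_i,v_i)$, $(x_i,y_i)$ denote the saddle points in $\psi_1$, $\psi_2$ at $(\lambda_i,\mu_i)$. $g(\lambda,\mu)=(\psi'_\lambda,-\psi'_\mu)$, with (partial sub-/supergradients at $z_i=(\lambda_i,\mu_i)$ given by) $\psi'_\lambda=\mathcal{C}v_i+\tilde y_0-y_i$, $\psi'_\mu=x_i-\tilde x_0-\mathcal{B}u_i$. Prox-functions $d_\lambda,d_\mu$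 with prox-centers $\lambda_0,\mu_0$ (minimizers with value $0$), strongly convex with parameters $\sigma_\lambda,\sigma_\mu$ in $\|\cdot\|_\lambda,\|\cdot\|_\mu$. For $\kappa\in(0,1)$ and $z=(\lambda,\mu)\in W=\mathbb{R}^m\times\mathbb{R}^n$: $\|z\|_z=\sqrt{\kappa\sigma_\lambda\|\lambda\|_\lambda^2+(1-\kappa)\sigma_\mu\|\mu\|_\mu^2}$, $d(z)=\kappa d_\lambda(\lambda)+(1-\kappa)d_\mu(\mu)$. $L^2=\frac{L_\lambda^2}{\kappa\sigma_\lambda}+\frac{L_\mu^2}{(1-\kappa)\sigma_\mu}$, $L_\lambda=\sqrt\theta\|\mathcal{C}\|_{\lambda,L^2_q}\operatorname{diam}_2Q+\operatorname{diam}_{\lambda,*}Y+\|\tilde y_0\|_{\lambda,*}$, $L_\mu=\sqrt\theta\|\mathcal{B}\|_{\mu,L^2_p}\operatorname{diam}_2P+\operatorname{diam}_{\mu,*}X+\|\tilde x_0\|_{\mu,*}$, where $\|\mathcal{B}\|_{\mu,L^2_p}=\max\{\langle\mu,\mathcal{B}u\rangle:\|\mu\|_\mu\le 1,\|u\|_{L^2_p}\le1\}$, similarly $\|\mathcal{C}\|_{\lambda,L^2_q}$, and subscripts of diam indicate the norm. Method (M1) (simple dual averages): $s_0=0$, $z_0=(\lambda_0,\mu_0)$, $\gamma>0$. For $k\ge0$: $g_k=g(z_k)$, $s_{k+1}=s_k+g_k$, $\beta_{k+1}=\gamma\hat\beta_{k+1}$, $z_{k+1}=\pi_{\beta_{k+1}}(-s_{k+1})$,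 with $\pi_\beta(s)=\arg\min_{z\in W}\{-\langle s,z\rangle+\beta d(z)\}$, $\hat\beta_0=\hat\beta_1=1$, $\hat\beta_{i+1}=\hat\beta_i+1/\hat\beta_i$ for $i\ge1$. The generated sequence $z_i=(\lambda_i,\mu_i)$ is bounded. $D_\lambda,D_\mu$ are such that $d_\lambda(\lambda_i)\le D_\lambda$, $d_\mu(\mu_i)\le D_\mu$ for all $i\ge0$, and for some $r>0$ the $\|\cdot\|_\lambda$-ball of radius $r/\sqrt{\kappa\sigma_\lambda}$ about $\lambda^*$ lies in $\{d_\lambda\le D_\lambda\}$ and the $\|\cdot\|_\mu$-ball of radius $r/\sqrt{(1-\kappa)\sigma_\mu}$ about $\mu^*$ lies in $\{d_\mu\le D_\mu\}$. $D=\kappa D_\lambda+(1-\kappa)D_\mu$. $\phi(u,x,v,y)=\min_\lambda\max_\mu\{F(u,v)+\Phi(x,y)+\langle\mu,x-\tilde x_0-\mathcal{B}u\rangle+\langle\lambda,\mathcal{C}v+\tilde y_0-y\rangle:d_\lambda(\lambda)\le D_\lambda,d_\mu(\mu)\le D_\mu\}$; $\xi(u,x)=\max_{v\in\mathcal{V},y\in Y}\phi(u,x,v,y)$; $\eta(v,y)=\min_{u\in\mathcal{U},x\in X}\phi(u,x,v,y)$. *)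

theory Defs
  imports "HOL-Analysis.Analysis"
begin

text \<open>Elements of $L^2([0,\theta])$ are represented by functions on the real line whose values
  outside $[0,\theta]$ are irrelevant.\<close>

definition L2_space :: "real \<Rightarrow> (real \<Rightarrow> 'a::euclidean_space) set" where
  "L2_space \<theta> = {u. u \<in> borel_measurable (lebesgue_on {0..\<theta>}) \<and>
                    integrable (lebesgue_on {0..\<theta>}) (\<lambda>t. (norm (u t))\<^sup>2)}"

definition l2_norm :: "real \<Rightarrow> (real \<Rightarrow> 'a::euclidean_space) \<Rightarrow> real" where
  "l2_norm \<theta> u = sqrt (integral\<^sup>L (lebesgue_on {0..\<theta>}) (\<lambda>t. (norm (u t))\<^sup>2))"

definition controls :: "real \<Rightarrow> 'a::euclidean_space set \<Rightarrow> (real \<Rightarrow> 'a) set" where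
  "controls \<theta> P = {u \<in> L2_space \<theta>. \<forall>t\<in>{0..\<theta>}. u t \<in> P}"

text \<open>Semicontinuity and convexity are spelled out because control functions are not elements of
  a type of class \<open>topological_space\<close> (with the $L^2$ topology) or \<open>real_vector\<close>.\<close>

definition L2_lower_semicontinuous_on ::
    "real \<Rightarrow> (real \<Rightarrow> 'a::euclidean_space) set \<Rightarrow> ((real \<Rightarrow> 'a) \<Rightarrow> real) \<Rightarrow> bool" where
  "L2_lower_semicontinuous_on \<theta> U f \<longleftrightarrow>
     (\<forall>u0\<in>U. \<forall>\<epsilon>>0. \<exists>\<delta>>0. \<forall>u\<in>U. l2_norm \<theta> (\<lambda>t. u t - u0 t) < \<delta> \<longrightarrow> f u0 - \<epsilon> < f u)"

definition L2_upper_semicontinuous_on ::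
    "real \<Rightarrow> (real \<Rightarrow> 'a::euclidean_space) set \<Rightarrow> ((real \<Rightarrow> 'a) \<Rightarrow> real) \<Rightarrow> bool" where
  "L2_upper_semicontinuous_on \<theta> U f \<longleftrightarrow> L2_lower_semicontinuous_on \<theta> U (\<lambda>u. - f u)"

definition functional_convex_on ::
    "(real \<Rightarrow> 'a::real_vector) set \<Rightarrow> ((real \<Rightarrow> 'a) \<Rightarrow> real) \<Rightarrow> bool" where
  "functional_convex_on U f \<longleftrightarrow>
     (\<forall>u1\<in>U. \<forall>u2\<in>U. \<forall>\<alpha>\<in>{0..1}.
        f (\<lambda>t. \<alpha> *\<^sub>R u1 t + (1 - \<alpha>) *\<^sub>R u2 t) \<le> \<alpha> * f u1 + (1 - \<alpha>) * f u2)"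

definition functional_concave_on ::
    "(real \<Rightarrow> 'a::real_vector) set \<Rightarrow> ((real \<Rightarrow> 'a) \<Rightarrow> real) \<Rightarrow> bool" where
  "functional_concave_on U f \<longleftrightarrow> functional_convex_on U (\<lambda>u. - f u)"

definition transition_matrix ::
    "real \<Rightarrow> (real \<Rightarrow> real^'n^'n) \<Rightarrow> (real \<Rightarrow> real \<Rightarrow> real^'n^'n) \<Rightarrow> bool" where
  "transition_matrix \<theta> A V \<longleftrightarrow>
     (\<forall>\<tau>\<in>{0..\<theta>}. V \<tau> \<tau> = mat 1 \<and>
        (\<forall>t\<in>{0..\<theta>}. ((\<lambda>t. V t \<tau>) has_vector_derivative (A t ** V t \<tau>)) (at t within {0..\<theta>})))"

text \<open>With initial state $x_0$ and control $u$ the system $\dot x = A x + B u$ reaches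
  $V(\theta,0)x_0 + {}$\<open>endpoint_op \<theta> V B u\<close> at time $\theta$ (variation of constants).\<close>

definition endpoint_op ::
    "real \<Rightarrow> (real \<Rightarrow> real \<Rightarrow> real^'n^'n) \<Rightarrow> (real \<Rightarrow> real^'p^'n) \<Rightarrow> (real \<Rightarrow> real^'p) \<Rightarrow> real^'n" where
  "endpoint_op \<theta> V B u =
     integral\<^sup>L (lebesgue_on {0..\<theta>}) (\<lambda>\<tau>. V \<theta> \<tau> *v (B \<tau> *v u \<tau>))"

definition is_norm :: "('a::real_vector \<Rightarrow> real) \<Rightarrow> bool" where
  "is_norm N \<longleftrightarrow> (\<forall>x. 0 \<le> N x) \<and> (\<forall>x. N x = 0 \<longleftrightarrow> x = 0) \<and>
     (\<forall>c x. N (c *\<^sub>R x) = \<bar>c\<bar> * N x) \<and> (\<forall>x y. N (x + y) \<le> N x + N y)"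

definition dual_norm :: "('a::real_inner \<Rightarrow> real) \<Rightarrow> 'a \<Rightarrow> real" where
  "dual_norm N s = Sup {s \<bullet> x | x. N x \<le> 1}"

definition diam_wrt :: "('a::real_vector \<Rightarrow> real) \<Rightarrow> 'a set \<Rightarrow> real" where
  "diam_wrt N S = (if S = {} then 0 else SUP (a, b)\<in>S \<times> S. N (a - b))"

definition L2_op_norm ::
    "('a::real_inner \<Rightarrow> real) \<Rightarrow> real \<Rightarrow> ((real \<Rightarrow> 'b::euclidean_space) \<Rightarrow> 'a) \<Rightarrow> real" where
  "L2_op_norm N \<theta> T = Sup {m \<bullet> T u | m u. N m \<le> 1 \<and> u \<in> L2_space \<theta> \<and> l2_norm \<theta> u \<le> 1}"

text \<open>The first argument is the minimizing one.\<close>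

definition saddle_point :: "('a \<Rightarrow> 'b \<Rightarrow> 'c::order) \<Rightarrow> 'a set \<Rightarrow> 'b set \<Rightarrow> 'a \<Rightarrow> 'b \<Rightarrow> bool" where
  "saddle_point f A B a b \<longleftrightarrow> a \<in> A \<and> b \<in> B \<and>
     (\<forall>b'\<in>B. f a b' \<le> f a b) \<and> (\<forall>a'\<in>A. f a b \<le> f a' b)"

text \<open>Min-max values are taken in the extended reals, so that an infinite inner supremum is not
  replaced by the arbitrary value that \<open>Sup\<close> has on unbounded sets of reals.\<close>

definition minmax :: "('a \<Rightarrow> 'b \<Rightarrow> real) \<Rightarrow> 'a set \<Rightarrow> 'b set \<Rightarrow> ereal" where
  "minmax f A B = (INF a\<in>A. SUP b\<in>B. ereal (f a b))"

definition strongly_convex :: "('a::real_vector \<Rightarrow> real) \<Rightarrow> real \<Rightarrow> ('a \<Rightarrow> real) \<Rightarrow> bool" where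
  "strongly_convex N \<sigma> d \<longleftrightarrow>
     (\<forall>x y. \<forall>\<alpha>\<in>{0..1}. d (\<alpha> *\<^sub>R x + (1 - \<alpha>) *\<^sub>R y)
        \<le> \<alpha> * d x + (1 - \<alpha>) * d y - \<sigma> / 2 * \<alpha> * (1 - \<alpha>) * (N (x - y))\<^sup>2)"

definition prox_function ::
    "('a::real_vector \<Rightarrow> real) \<Rightarrow> real \<Rightarrow> ('a \<Rightarrow> real) \<Rightarrow> 'a \<Rightarrow> bool" where
  "prox_function N \<sigma> d c \<longleftrightarrow> 0 < \<sigma> \<and> strongly_convex N \<sigma> d \<and>
     is_arg_min d (\<lambda>_. True) c \<and> d c = 0"

fun beta_hat :: "nat \<Rightarrow> real" where
  "beta_hat 0 = 1"
| "beta_hat (Suc 0) = 1"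
| "beta_hat (Suc (Suc i)) = beta_hat (Suc i) + 1 / beta_hat (Suc i)"

text \<open>\<open>is_prox_map \<beta> d s z\<close> says that $z = \pi_\beta(s)$.\<close>

definition is_prox_map :: "real \<Rightarrow> ('a::real_inner \<Rightarrow> real) \<Rightarrow> 'a \<Rightarrow> 'a \<Rightarrow> bool" where
  "is_prox_map \<beta> d s z \<longleftrightarrow> is_arg_min (\<lambda>w. - (s \<bullet> w) + \<beta> * d w) (\<lambda>_. True) z"

definition simple_dual_averages ::
    "real \<Rightarrow> ('a::real_inner \<Rightarrow> real) \<Rightarrow> 'a \<Rightarrow> (nat \<Rightarrow> 'a) \<Rightarrow> (nat \<Rightarrow> 'a) \<Rightarrow> (nat \<Rightarrow> 'a) \<Rightarrow> bool" where
  "simple_dual_averages \<gamma> d c g s z \<longleftrightarrow> s 0 = 0 \<and> z 0 = c \<and>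
     (\<forall>k. s (Suc k) = s k + g k \<and>
          is_prox_map (\<gamma> * beta_hat (Suc k)) d (- s (Suc k)) (z (Suc k)))"

end

theory Submission
  imports Defs
begin

text \<open>Adding the saddle inequalities of the two subproblems at $z_i = (\lambda_i,\mu_i)$ and using
  convexity-concavity, the difference of the saddle functions underlying $\xi$ and $\eta$ is at most
  $\frac{1}{k+1}\sum_i \langle g_i, z_i - z\rangle$, where $z$ ranges over the prox-balls and the
  averages of $\lambda_i$ and $\mu_i$ are plugged in for the other multipliers. The regret estimate
  of dual averaging bounds this sum. As $z^*$ is a saddle point of the convex-concave function
  $\psi$, with partial sub- and supergradients given by $g_i$, one has
  $\langle g_i, z_i - z^*\rangle \ge 0$. Evaluating the sum at $z = z^* + h$ and
  dropping these terms leaves $-\langle \sum_i g_i, h\rangle$; as $h$ may be any vector of norm at most $r$, this bounds the residuals. The norm of $g_i$ is controlled by the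
  diameters of $X$ and $Y$ alone, since $\tilde x_0 + \mathcal{B}u_i \in X$ and
  $\tilde y_0 + \mathcal{C}v_i \in Y$.\<close>

section \<open>Dual norms\<close>

lemma is_norm_uminus:
  assumes "is_norm N" shows "N (- x) = N x"
  using assms unfolding is_norm_def by (metis abs_minus_cancel abs_one mult_1 scaleR_minus1_left)

lemma is_norm_convex_on:
  fixes N :: "'a::euclidean_space \<Rightarrow> real"
  assumes "is_norm N" shows "convex_on UNIV N"
proof (rule convex_onI)
  fix t x y assume "0 < t" "t < (1::real)"
  then show "N ((1 - t) *\<^sub>R x + t *\<^sub>R y) \<le> (1 - t) * N x + t * N y"
    using assms unfolding is_norm_def by (metis abs_of_pos diff_gt_0_iff_gt)
qed simp

text \<open>Convexity makes \<open>N\<close> continuous, so it attains a minimum on the compact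
  Euclidean unit sphere. Definiteness makes that minimum positive, and by homogeneity its inverse
  can serve as \<open>c\<close>.\<close>

lemma norm_le_is_norm:
  fixes N :: "'a::euclidean_space \<Rightarrow> real"
  assumes N: "is_norm N"
  obtains c where "0 < c" "\<And>x. norm x \<le> c * N x"
proof -
  have cont: "continuous_on (sphere 0 1) N"
    using convex_on_continuous[OF open_UNIV is_norm_convex_on[OF N]] continuous_on_subset by blast
  obtain b :: 'a where "b \<in> Basis" using nonempty_Basis by blast
  then have "sphere (0::'a) 1 \<noteq> {}" by (auto intro!: exI[of _ b])
  then obtain a where a: "a \<in> sphere 0 1" "\<And>x. x \<in> sphere 0 1 \<Longrightarrow> N a \<le> N x"
    using continuous_attains_inf[OF compact_sphere _ cont] by blast
  have pos: "0 < N a"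
    using N a(1) unfolding is_norm_def by (metis dist_0_norm mem_sphere norm_zero order_le_less zero_neq_one)
  show thesis
  proof
    show "0 < 1 / N a" using pos by simp
    fix x :: 'a
    show "norm x \<le> 1 / N a * N x"
    proof (cases "x = 0")
      case True then show ?thesis using N pos by (simp add: is_norm_def)
    next
      case False
      have "N a \<le> N ((1 / norm x) *\<^sub>R x)" using a(2) False by simp
      also have "\<dots> = N x / norm x" using N False by (simp add: is_norm_def)
      finally show ?thesis using False pos by (simp add: field_simps)
    qed
  qed
qed

text \<open>A real \<open>Sup\<close> is meaningful only on sets that are bounded above; this
  supplies the bound for the set in \<open>dual_norm\<close>. As \<open>c\<close> does not depend on
  \<open>s\<close>, it also bounds dual norms uniformly over bounded sets.\<close>

lemma inner_le_norm_on_unit_ball: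
  fixes N :: "'a::euclidean_space \<Rightarrow> real"
  assumes "is_norm N"
  obtains c where "0 < c" "\<And>s x. N x \<le> 1 \<Longrightarrow> s \<bullet> x \<le> c * norm s"
proof -
  obtain c where c: "0 < c" "\<And>x. norm x \<le> c * N x" using norm_le_is_norm[OF assms] by blast
  show thesis
  proof
    fix s x :: 'a assume "N x \<le> 1"
    then have "norm x \<le> c" using c(2)[of x] mult_left_le[of "N x" c] c(1) by linarith
    then have "norm s * norm x \<le> c * norm s"
      by (metis mult.commute mult_right_mono norm_ge_zero)
    then show "s \<bullet> x \<le> c * norm s" using norm_cauchy_schwarz[of s x] by linarith
  qed (fact c(1))
qed

lemma dual_norm_upper:
  fixes N :: "'a::euclidean_space \<Rightarrow> real"
  assumes "is_norm N" "N x \<le> 1"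
  shows "s \<bullet> x \<le> dual_norm N s"
proof -
  obtain c where "\<And>s x. N x \<le> 1 \<Longrightarrow> s \<bullet> x \<le> c * norm s" using inner_le_norm_on_unit_ball[OF assms(1)] by blast
  then have "bdd_above {s \<bullet> x | x. N x \<le> 1}" unfolding bdd_above_def by blast
  then show ?thesis unfolding dual_norm_def using assms(2) by (intro cSup_upper) auto
qed

lemma dual_norm_least:
  fixes N :: "'a::real_inner \<Rightarrow> real"
  assumes "is_norm N" "\<And>x. N x \<le> 1 \<Longrightarrow> s \<bullet> x \<le> K"
  shows "dual_norm N s \<le> K"
proof -
  have "N 0 = 0" using assms(1) by (simp add: is_norm_def)
  then have "{s \<bullet> x | x. N x \<le> 1} \<noteq> {}" by (auto intro!: exI[of _ 0])
  then show ?thesis unfolding dual_norm_def using assms(2) by (intro cSup_least) auto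
qed

lemma dual_norm_nonneg:
  fixes N :: "'a::euclidean_space \<Rightarrow> real"
  assumes "is_norm N" shows "0 \<le> dual_norm N s"
proof -
  have "N 0 = 0" using assms by (simp add: is_norm_def)
  then show ?thesis using dual_norm_upper[OF assms, of 0 s] by simp
qed

lemma inner_le_dual_norm:
  fixes N :: "'a::euclidean_space \<Rightarrow> real"
  assumes "is_norm N" shows "s \<bullet> x \<le> dual_norm N s * N x"
proof (cases "x = 0")
  case True
  moreover have "N 0 = 0" using assms by (simp add: is_norm_def)
  ultimately show ?thesis by simp
next
  case False
  then have pos: "0 < N x" using assms unfolding is_norm_def by (metis order_le_less)
  then have "N ((1 / N x) *\<^sub>R x) \<le> 1" using assms by (simp add: is_norm_def)
  from dual_norm_upper[OF assms this, of s] show ?thesis using pos by (simp add: field_simps)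
qed

text \<open>\<open>diam_wrt\<close> is a real supremum, so the work lies in bounding the dual norms
  of all differences: those differences have Euclidean norm at most \<open>2 * R\<close>, and the
  uniform constant \<open>c\<close> converts this.\<close>

lemma dual_norm_diff_le_diam:
  fixes N :: "'a::euclidean_space \<Rightarrow> real"
  assumes "is_norm N" "bounded S" "a \<in> S" "b \<in> S"
  shows "dual_norm N (a - b) \<le> diam_wrt (dual_norm N) S"
proof -
  obtain c where c: "0 < c" "\<And>s x. N x \<le> 1 \<Longrightarrow> s \<bullet> x \<le> c * norm s"
    using inner_le_norm_on_unit_ball[OF assms(1)] by blast
  obtain R where R: "\<And>a. a \<in> S \<Longrightarrow> norm a \<le> R" using \<open>bounded S\<close> bounded_iff by blast
  have "dual_norm N (a - b) \<le> c * (2 * R)" if "a \<in> S" "b \<in> S" for a b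
  proof -
    have "norm (a - b) \<le> 2 * R" using R[OF that(1)] R[OF that(2)] norm_triangle_ineq4[of a b] by linarith
    then have "c * norm (a - b) \<le> c * (2 * R)" using c(1) by (intro mult_left_mono) auto
    then show ?thesis using c(2) by (intro dual_norm_least[OF assms(1)]) (meson order_trans)
  qed
  then have "bdd_above ((\<lambda>(a, b). dual_norm N (a - b)) ` (S \<times> S))"
    by (intro bdd_aboveI[of _ "c * (2 * R)"]) auto
  then have "(\<lambda>(a, b). dual_norm N (a - b)) (a, b) \<le> (SUP (a, b)\<in>S \<times> S. dual_norm N (a - b))"
    using assms(3,4) by (intro cSUP_upper) auto
  then show ?thesis using assms(3) unfolding diam_wrt_def by auto
qed

text \<open>Last step of both residual estimates: moving by
  \<open>r / sqrt (\<kappa> * \<sigma>)\<close> in every unit direction costs at most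
  \<open>E\<close>, which gives the factor \<open>sqrt (\<kappa> * \<sigma>) / r\<close>. Since
  \<kappa> is at most 1 and \<open>E\<close> is nonnegative, it may be enlarged to
  \<open>sqrt \<sigma> / r\<close>. For the second multiplier \<kappa> is instantiated with 1 -
  \<kappa>.\<close>

lemma dual_norm_scaled_le:
  fixes N :: "'a::euclidean_space \<Rightarrow> real"
  assumes "is_norm N" "0 < \<sigma>" "0 < \<kappa>" "\<kappa> \<le> 1" "0 < r" "0 < n" "0 \<le> E"
    and le: "\<And>w. N w \<le> 1 \<Longrightarrow> r / sqrt (\<kappa> * \<sigma>) * (s \<bullet> w) \<le> E"
  shows "dual_norm N ((1 / n) *\<^sub>R s) \<le> sqrt \<sigma> / (r * n) * E"
proof (rule dual_norm_least[OF assms(1)])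
  fix w assume "N w \<le> 1"
  have "s \<bullet> w \<le> sqrt (\<kappa> * \<sigma>) * E / r"
    using le[OF \<open>N w \<le> 1\<close>] assms by (simp add: field_simps)
  also have "\<dots> \<le> sqrt \<sigma> * E / r"
    using assms by (intro divide_right_mono mult_right_mono real_sqrt_le_mono) auto
  finally show "(1 / n) *\<^sub>R s \<bullet> w \<le> sqrt \<sigma> / (r * n) * E"
    using assms by (simp add: field_simps)
qed

section \<open>Dual averaging\<close>

text \<open>The quadratic term only helps, so \<open>d\<close> is convex. This later keeps averages
  of the multipliers inside the prox-balls.\<close>

lemma strongly_convex_imp_convex_sublevel:
  assumes "strongly_convex N \<sigma> d" "0 \<le> \<sigma>"
  shows "convex {x. d x \<le> c}"
proof (rule convexI)
  fix x y and u v :: real assume *: "x \<in> {x. d x \<le> c}" "y \<in> {x. d x \<le> c}" "0 \<le> u" "0 \<le> v" "u + v = 1"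
  then have v: "v = 1 - u" "u \<le> 1" by auto
  have "d (u *\<^sub>R x + v *\<^sub>R y) \<le> u * d x + v * d y - \<sigma> / 2 * u * v * (N (x - y))\<^sup>2"
    using assms(1) * v unfolding strongly_convex_def by auto
  also have "\<dots> \<le> u * d x + v * d y" using * assms(2) by simp
  also have "\<dots> \<le> c" using * by (intro convex_bound_le) auto
  finally show "u *\<^sub>R x + v *\<^sub>R y \<in> {x. d x \<le> c}" by simp
qed

text \<open>Add \<open>a\<close> times the first inequality to \<open>b\<close> times the second.
  The weights and moduli are absorbed into the norm on the product, so that the parameter of the sum
  is exactly 1.\<close>

lemma strongly_convex_Pair:
  assumes "strongly_convex N1 \<sigma>1 d1" "strongly_convex N2 \<sigma>2 d2" "0 \<le> a" "0 \<le> b" "0 \<le> \<sigma>1" "0 \<le> \<sigma>2"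
  shows "strongly_convex (\<lambda>(l, m). sqrt (a * \<sigma>1 * (N1 l)\<^sup>2 + b * \<sigma>2 * (N2 m)\<^sup>2)) 1 (\<lambda>(l, m). a * d1 l + b * d2 m)"
  unfolding strongly_convex_def
proof (intro allI ballI)
  fix z w :: "'a \<times> 'b" and \<alpha> :: real assume \<alpha>: "\<alpha> \<in> {0..1}"
  obtain l m l' m' where zw: "z = (l, m)" "w = (l', m')" by fastforce
  have "a * d1 (\<alpha> *\<^sub>R l + (1 - \<alpha>) *\<^sub>R l')
      \<le> a * (\<alpha> * d1 l + (1 - \<alpha>) * d1 l' - \<sigma>1 / 2 * \<alpha> * (1 - \<alpha>) * (N1 (l - l'))\<^sup>2)"
    using assms(1,3) \<alpha> unfolding strongly_convex_def by (intro mult_left_mono) auto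
  moreover have "b * d2 (\<alpha> *\<^sub>R m + (1 - \<alpha>) *\<^sub>R m')
      \<le> b * (\<alpha> * d2 m + (1 - \<alpha>) * d2 m' - \<sigma>2 / 2 * \<alpha> * (1 - \<alpha>) * (N2 (m - m'))\<^sup>2)"
    using assms(2,4) \<alpha> unfolding strongly_convex_def by (intro mult_left_mono) auto
  moreover have "0 \<le> a * \<sigma>1 * (N1 (l - l'))\<^sup>2 + b * \<sigma>2 * (N2 (m - m'))\<^sup>2" using assms by simp
  ultimately show "(case \<alpha> *\<^sub>R z + (1 - \<alpha>) *\<^sub>R w of (l, m) \<Rightarrow> a * d1 l + b * d2 m)
      \<le> \<alpha> * (case z of (l, m) \<Rightarrow> a * d1 l + b * d2 m) + (1 - \<alpha>) * (case w of (l, m) \<Rightarrow> a * d1 l + b * d2 m)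
        - 1 / 2 * \<alpha> * (1 - \<alpha>) * (case z - w of (l, m) \<Rightarrow> sqrt (a * \<sigma>1 * (N1 l)\<^sup>2 + b * \<sigma>2 * (N2 m)\<^sup>2))\<^sup>2"
    unfolding zw by (simp add: algebra_simps)
qed

lemma beta_hat_pos: "0 < beta_hat n"
  by (induction n rule: beta_hat.induct) (auto simp: add_pos_pos)

lemma beta_hat_mono_Suc: "beta_hat n \<le> beta_hat (Suc n)"
  using beta_hat_pos by (cases n) (auto simp: less_imp_le)

text \<open>The recursion telescopes. The doubled initial value 1 makes the term of index 0 equal to
  \<open>beta_hat 1\<close>, so the sum may start at 0.\<close>

lemma sum_inverse_beta_hat: "(\<Sum>i=0..k. 1 / beta_hat i) = beta_hat (Suc k)"
  by (induction k) auto

text \<open>Compare the minimizer \<open>z\<close> with the point at fraction \<alpha> of the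
  segment from \<open>z\<close> to \<open>w\<close>. Minimality and strong convexity, divided by
  \<alpha>, give the claim with an extra factor 1 - \<alpha> on the quadratic term; letting \<alpha>
  tend to 0 from the right removes it.\<close>

lemma strongly_convex_quadratic_growth:
  fixes d :: "'a::real_inner \<Rightarrow> real"
  assumes sc: "strongly_convex N 1 d" and "0 \<le> \<beta>" and z: "is_prox_map \<beta> d s z"
  shows "- (s \<bullet> z) + \<beta> * d z + \<beta> / 2 * (N (w - z))\<^sup>2 \<le> - (s \<bullet> w) + \<beta> * d w"
proof -
  define h where "h = (\<lambda>w. - (s \<bullet> w) + \<beta> * d w)"
  have min: "h z \<le> h x" for x
    using z unfolding is_prox_map_def h_def is_arg_min_linorder by auto
  have *: "h z + \<beta> / 2 * (1 - \<alpha>) * (N (w - z))\<^sup>2 \<le> h w" if "0 < \<alpha>" "\<alpha> \<le> 1" for \<alpha>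
  proof -
    let ?p = "\<alpha> *\<^sub>R w + (1 - \<alpha>) *\<^sub>R z"
    have "d ?p \<le> \<alpha> * d w + (1 - \<alpha>) * d z - 1 / 2 * \<alpha> * (1 - \<alpha>) * (N (w - z))\<^sup>2"
      using sc that unfolding strongly_convex_def by auto
    then have "\<beta> * d ?p \<le> \<beta> * (\<alpha> * d w + (1 - \<alpha>) * d z - 1 / 2 * \<alpha> * (1 - \<alpha>) * (N (w - z))\<^sup>2)"
      using \<open>0 \<le> \<beta>\<close> by (rule mult_left_mono)
    then have "h ?p \<le> h z + \<alpha> * (h w - h z - \<beta> / 2 * (1 - \<alpha>) * (N (w - z))\<^sup>2)"
      unfolding h_def by (simp add: inner_add_right algebra_simps)
    with min[of ?p] have "0 \<le> \<alpha> * (h w - h z - \<beta> / 2 * (1 - \<alpha>) * (N (w - z))\<^sup>2)" by linarith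
    then show ?thesis using \<open>0 < \<alpha>\<close> by (simp add: zero_le_mult_iff)
  qed
  have "((\<lambda>\<alpha>. h z + \<beta> / 2 * (1 - \<alpha>) * (N (w - z))\<^sup>2) \<longlongrightarrow> h z + \<beta> / 2 * (1 - 0) * (N (w - z))\<^sup>2) (at_right 0)"
    by (intro tendsto_intros)
  moreover have "\<forall>\<^sub>F \<alpha> in at_right 0. h z + \<beta> / 2 * (1 - \<alpha>) * (N (w - z))\<^sup>2 \<le> h w"
    by (rule eventually_at_rightI[of 0 1]) (use * in auto)
  ultimately have "h z + \<beta> / 2 * (1 - 0) * (N (w - z))\<^sup>2 \<le> h w"
    by (rule tendsto_upperbound) simp
  then show ?thesis unfolding h_def by simp
qed

text \<open>The minimal value of $\langle s_k,\cdot\rangle + \beta_k d$ grows by at least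
  $\langle g_k,z_k\rangle - L^2/(2\beta_k)$ in each step, because the quadratic growth around the
  minimizer $z_k$ absorbs the linear perturbation $g_k$.\<close>

lemma simple_dual_averages_gap:
  fixes d :: "'a::real_inner \<Rightarrow> real"
  assumes M: "simple_dual_averages \<gamma> d c g s z" and "0 < \<gamma>"
    and sc: "strongly_convex N 1 d" and c: "is_arg_min d (\<lambda>_. True) c" "d c = 0"
    and g: "\<And>i w. - (g i \<bullet> w) \<le> L * N w"
  shows "(\<Sum>i=0..k. g i \<bullet> (z i - w)) \<le> beta_hat (Suc k) * (\<gamma> * d w + L\<^sup>2 / (2 * \<gamma>))"
proof -
  define \<beta> where "\<beta> = (\<lambda>i. \<gamma> * beta_hat i)"
  define m where "m = (\<lambda>k. s k \<bullet> z k + \<beta> k * d (z k))"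
  have s: "s 0 = 0" "\<And>k. s (Suc k) = s k + g k" and z0: "z 0 = c"
    and prox': "\<And>k. is_prox_map (\<gamma> * beta_hat (Suc k)) d (- s (Suc k)) (z (Suc k))"
    using M unfolding simple_dual_averages_def by blast+
  have d_nonneg: "0 \<le> d w" for w using c by (auto simp: is_arg_min_linorder)
  have \<beta>_pos: "0 < \<beta> k" and \<beta>_mono: "\<beta> k \<le> \<beta> (Suc k)" for k
    unfolding \<beta>_def using \<open>0 < \<gamma>\<close> beta_hat_pos beta_hat_mono_Suc by auto
  \<comment> \<open>The method prescribes the prox-map only from index 1 on. At index 0 the linear
    term vanishes and the prox-center minimizes \<open>d\<close>, so the same description holds
    there.\<close>
  have prox: "is_prox_map (\<beta> k) d (- s k) (z k)" for k
  proof (cases k)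
    case 0
    then show ?thesis using s z0 c d_nonneg \<beta>_pos[of 0]
      unfolding is_prox_map_def is_arg_min_linorder by auto
  next
    case (Suc j) then show ?thesis using prox' unfolding \<beta>_def by auto
  qed
  have step: "m k + g k \<bullet> z k - L\<^sup>2 / (2 * \<beta> k) \<le> m (Suc k)" for k
  proof -
    let ?w = "z (Suc k)" and ?n = "N (z (Suc k) - z k)"
    have "m k + \<beta> k / 2 * ?n\<^sup>2 \<le> s k \<bullet> ?w + \<beta> k * d ?w"
      using strongly_convex_quadratic_growth[OF sc _ prox[of k], of ?w] \<beta>_pos[of k]
      unfolding m_def by simp
    moreover have "\<beta> k * d ?w \<le> \<beta> (Suc k) * d ?w"
      using \<beta>_mono[of k] d_nonneg by (rule mult_right_mono)
    \<comment> \<open>Young's inequality for \<open>L\<close> and \<open>\<beta> k * ?n\<close>,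
      divided by \<open>2 * \<beta> k\<close>.\<close>
    moreover have "- (L\<^sup>2 / (2 * \<beta> k)) - \<beta> k / 2 * ?n\<^sup>2 \<le> - (L * ?n)"
    proof -
      have "L * ?n * (2 * \<beta> k) \<le> L\<^sup>2 + (\<beta> k * ?n)\<^sup>2"
        using sum_squares_bound[of L "\<beta> k * ?n"] by (simp add: algebra_simps)
      then show ?thesis using \<beta>_pos[of k] by (simp add: field_simps power2_eq_square)
    qed
    moreover have "g k \<bullet> z k - L * ?n \<le> g k \<bullet> ?w"
      using g[of k "?w - z k"] by (simp add: inner_diff_right)
    ultimately show ?thesis unfolding m_def by (simp add: s inner_add_left)
  qed
  \<comment> \<open>Summing the steps telescopes from \<open>m 0\<close>, which is 0 because
    \<open>s 0\<close> is 0 and \<open>d\<close> vanishes at the prox-center.\<close>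
  have "(\<Sum>i=0..k. g i \<bullet> z i) - (\<Sum>i=0..k. L\<^sup>2 / (2 * \<beta> i)) \<le> m (Suc k)" for k
  proof (induction k)
    case 0
    then show ?case using step[of 0] by (simp add: m_def s z0 c)
  next
    case (Suc k) then show ?case using step[of "Suc k"] by simp
  qed
  \<comment> \<open>\<open>m (Suc k)\<close> is a minimal value, hence at most the value at the
    arbitrary comparison point \<open>w\<close>.\<close>
  moreover have "m (Suc k) \<le> s (Suc k) \<bullet> w + \<beta> (Suc k) * d w"
    using prox[of "Suc k"] unfolding is_prox_map_def m_def is_arg_min_linorder by auto
  moreover have "s (Suc k) = (\<Sum>i=0..k. g i)"
    by (induction k) (auto simp: s)
  moreover have "(\<Sum>i=0..k. L\<^sup>2 / (2 * \<beta> i)) = beta_hat (Suc k) * (L\<^sup>2 / (2 * \<gamma>))"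
    unfolding sum_inverse_beta_hat[symmetric] sum_distrib_right \<beta>_def by (simp add: field_simps)
  ultimately have "(\<Sum>i=0..k. g i \<bullet> z i) - beta_hat (Suc k) * (L\<^sup>2 / (2 * \<gamma>))
      \<le> (\<Sum>i=0..k. g i \<bullet> w) + \<gamma> * beta_hat (Suc k) * d w"
    by (simp add: inner_sum_left \<beta>_def del: beta_hat.simps) (smt (verit))
  then show ?thesis
    by (simp add: inner_diff_right sum_subtractf algebra_simps del: beta_hat.simps)
qed

section \<open>Transition matrices\<close>

lemma bounded_bilinear_matrix_vector_mult:
  "bounded_bilinear ((*v) :: real^'n^'m \<Rightarrow> real^'n \<Rightarrow> real^'m)"
  unfolding bilinear_conv_bounded_bilinear[symmetric] bilinear_def
  by (auto intro!: linearI simp: matrix_vector_mult_add_rdistrib scaleR_matrix_vector_assoc[symmetric])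

text \<open>Gronwall's argument in both time directions. With \<open>A\<close> bounded, the
  derivative of |y|^2 is at most 2M|y|^2 in absolute value, so exp(-2Mt)|y|^2 is nonincreasing and
  exp(2Mt)|y|^2 is nondecreasing. The first carries the zero at \<tau> to later times, the second to
  earlier ones.\<close>

lemma linear_ode_zero:
  fixes A :: "real \<Rightarrow> real^'n^'n" and y :: "real \<Rightarrow> real^'n"
  assumes A: "continuous_on {0..\<theta>} A"
    and y: "\<And>t. t \<in> {0..\<theta>} \<Longrightarrow> (y has_vector_derivative (A t *v y t)) (at t within {0..\<theta>})"
    and \<tau>: "\<tau> \<in> {0..\<theta>}" "y \<tau> = 0" and t: "t \<in> {0..\<theta>}"
  shows "y t = 0"
proof -
  interpret mv: bounded_bilinear "(*v) :: real^'n^'n \<Rightarrow> real^'n \<Rightarrow> real^'n"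
    by (rule bounded_bilinear_matrix_vector_mult)
  obtain K where K: "0 \<le> K" "\<And>M z. norm (M *v z :: real^'n) \<le> norm (M :: real^'n^'n) * norm z * K"
    using mv.nonneg_bounded by blast
  obtain a where a: "\<And>t. t \<in> {0..\<theta>} \<Longrightarrow> norm (A t) \<le> a"
    using compact_imp_bounded[OF compact_continuous_image[OF A compact_Icc]]
    unfolding bounded_iff by blast
  define M where "M = a * K"
  have est: "\<bar>y t \<bullet> (A t *v y t)\<bar> \<le> M * (y t \<bullet> y t)" if "t \<in> {0..\<theta>}" for t
  proof -
    have "\<bar>y t \<bullet> (A t *v y t)\<bar> \<le> norm (y t) * (norm (A t) * norm (y t) * K)"
      using Cauchy_Schwarz_ineq2[of "y t" "A t *v y t"] K(2)[of "A t" "y t"]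
      by (meson mult_left_mono norm_ge_zero order_trans)
    also have "\<dots> \<le> norm (y t) * (a * norm (y t) * K)"
      using a[OF that] K(1) by (intro mult_left_mono mult_right_mono) auto
    also have "\<dots> = M * (y t \<bullet> y t)" by (simp add: M_def dot_square_norm power2_eq_square)
    finally show ?thesis .
  qed
  define h where "h = (\<lambda>c t. exp (c * t) * (y t \<bullet> y t))"
  have cont_y: "continuous_on {0..\<theta>} y"
    by (rule continuous_on_vector_derivative[OF y])
  have cont: "continuous_on {0..\<theta>} (h c)" for c
    unfolding h_def by (intro continuous_intros cont_y)
  \<comment> \<open>At the end points only a one-sided derivative is given, hence the restriction to
    the interior; the monotonicity rules used below ask only for continuity at the ends.\<close>
  have der: "(h c has_real_derivative exp (c * t) * (c * (y t \<bullet> y t) + 2 * (y t \<bullet> (A t *v y t)))) (at t)"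
    if "0 < t" "t < \<theta>" for c t
  proof -
    have "(y has_vector_derivative (A t *v y t)) (at t)"
      using y[of t] that by (simp add: at_within_Icc_at)
    then have "(y has_derivative (\<lambda>h. h *\<^sub>R (A t *v y t))) (at t)"
      by (simp add: has_vector_derivative_def)
    then have "((\<lambda>t. y t \<bullet> y t) has_derivative (\<lambda>h. h * (2 * (y t \<bullet> (A t *v y t))))) (at t)"
      by (auto intro!: derivative_eq_intros simp: inner_commute)
    then have "((\<lambda>t. y t \<bullet> y t) has_real_derivative 2 * (y t \<bullet> (A t *v y t))) (at t)"
      by (simp add: has_field_derivative_def mult_commute_abs)
    then show ?thesis unfolding h_def
      by (auto intro!: derivative_eq_intros simp: algebra_simps)
  qed
  have "y t \<bullet> y t \<le> 0"
  proof (cases "\<tau> \<le> t")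
    case True
    have "h (- 2 * M) t \<le> h (- 2 * M) \<tau>"
    proof (rule DERIV_nonpos_imp_decreasing_open[OF True])
      fix s assume s: "\<tau> < s" "s < t"
      then have s': "s \<in> {0..\<theta>}" "0 < s" "s < \<theta>" using \<tau> t by auto
      have "- 2 * M * (y s \<bullet> y s) + 2 * (y s \<bullet> (A s *v y s)) \<le> 0" using est[OF s'(1)] by linarith
      then show "\<exists>z. (h (- 2 * M) has_real_derivative z) (at s) \<and> z \<le> 0"
        using der[OF s'(2,3)] by (meson exp_ge_zero mult_nonneg_nonpos)
    qed (use cont[of "- 2 * M"] \<tau> t in \<open>auto elim!: continuous_on_subset\<close>)
    then show ?thesis by (simp add: h_def \<tau> mult_le_0_iff)
  next
    case False
    have "h (2 * M) t \<le> h (2 * M) \<tau>"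
    proof (rule DERIV_nonneg_imp_increasing_open[of t \<tau>])
      fix s assume s: "t < s" "s < \<tau>"
      then have s': "s \<in> {0..\<theta>}" "0 < s" "s < \<theta>" using \<tau> t by auto
      have "0 \<le> 2 * M * (y s \<bullet> y s) + 2 * (y s \<bullet> (A s *v y s))" using est[OF s'(1)] by linarith
      then show "\<exists>z. (h (2 * M) has_real_derivative z) (at s) \<and> 0 \<le> z"
        using der[OF s'(2,3)] by (meson exp_ge_zero mult_nonneg_nonneg)
    qed (use cont[of "2 * M"] \<tau> t False in \<open>auto elim!: continuous_on_subset\<close>)
    then show ?thesis by (simp add: h_def \<tau> mult_le_0_iff)
  qed
  then show ?thesis by (metis inner_eq_zero_iff inner_ge_zero order_antisym)
qed

lemma continuous_on_det:
  fixes A :: "'a::topological_space \<Rightarrow> real^'n^'n"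
  assumes "\<And>i j. continuous_on S (\<lambda>x. A x $ i $ j)"
  shows "continuous_on S (\<lambda>x. det (A x))"
  unfolding det_def by (intro continuous_on_sum continuous_on_mult continuous_on_prod continuous_on_const assms)

text \<open>Applied to a vector \<open>w\<close>, both sides solve the same linear equation in
  \<open>t\<close> and agree at \<open>t = \<tau>\<close>. Their difference vanishes by
  \<open>linear_ode_zero\<close>, also for \<open>t\<close> before \<tau>.\<close>

lemma transition_matrix_compose:
  fixes V :: "real \<Rightarrow> real \<Rightarrow> real^'n^'n"
  assumes V: "transition_matrix \<theta> A V" and A: "continuous_on {0..\<theta>} A"
    and t: "t \<in> {0..\<theta>}" and \<tau>: "\<tau> \<in> {0..\<theta>}" and \<rho>: "\<rho> \<in> {0..\<theta>}"
  shows "V t \<tau> ** V \<tau> \<rho> = V t \<rho>"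
proof -
  have V': "V \<tau> \<tau> = mat 1" "((\<lambda>t. V t \<tau>) has_vector_derivative (A t ** V t \<tau>)) (at t within {0..\<theta>})"
    if "\<tau> \<in> {0..\<theta>}" "t \<in> {0..\<theta>}" for t \<tau>
    using V that unfolding transition_matrix_def by auto
  have lin: "bounded_linear (\<lambda>M. M *v w)" for w :: "real^'n"
    using bounded_bilinear.bounded_linear_left[OF bounded_bilinear_matrix_vector_mult] .
  have "V t \<tau> *v (V \<tau> \<rho> *v w) - V t \<rho> *v w = 0" for w
  proof (rule linear_ode_zero[OF A _ \<tau> _ t])
    show "V \<tau> \<tau> *v (V \<tau> \<rho> *v w) - V \<tau> \<rho> *v w = 0" using V' \<tau> by simp
    fix t assume t: "t \<in> {0..\<theta>}"
    show "((\<lambda>t. V t \<tau> *v (V \<tau> \<rho> *v w) - V t \<rho> *v w) has_vector_derivative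
        A t *v (V t \<tau> *v (V \<tau> \<rho> *v w) - V t \<rho> *v w)) (at t within {0..\<theta>})"
      using has_vector_derivative_diff[OF bounded_linear.has_vector_derivative[OF lin V'(2)[OF \<tau> t]]
         bounded_linear.has_vector_derivative[OF lin V'(2)[OF \<rho> t]], of "V \<tau> \<rho> *v w" w]
      by (simp add: matrix_vector_mult_diff_distrib matrix_vector_mul_assoc matrix_mul_assoc)
  qed
  then show ?thesis by (auto simp: matrix_eq matrix_vector_mul_assoc[symmetric])
qed

text \<open>As $V(\theta,\tau) = V(\theta,0)V(\tau,0)^{-1}$, Cramer's rule turns continuity in the first
  argument into continuity in the second one.\<close>

lemma continuous_on_transition_matrix:
  fixes V :: "real \<Rightarrow> real \<Rightarrow> real^'n^'n"
  assumes V: "transition_matrix \<theta> A V" and A: "continuous_on {0..\<theta>} A" and "0 < \<theta>"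
  shows "continuous_on {0..\<theta>} (V \<theta>)"
proof -
  have 0: "0 \<in> {0..\<theta>}" and \<theta>: "\<theta> \<in> {0..\<theta>}" using \<open>0 < \<theta>\<close> by auto
  have id: "V 0 0 = mat 1" "V \<tau> \<tau> = mat 1" if "\<tau> \<in> {0..\<theta>}" for \<tau>
    using V that 0 unfolding transition_matrix_def by auto
  have cV: "continuous_on {0..\<theta>} (\<lambda>t. V t 0)"
    using V 0 unfolding transition_matrix_def by (meson continuous_on_vector_derivative)
  have det: "det (V \<tau> 0) \<noteq> 0" if "\<tau> \<in> {0..\<theta>}" for \<tau>
  proof -
    have "V \<tau> 0 ** V 0 \<tau> = mat 1" using transition_matrix_compose[OF V A that 0 that] id that by simp
    then show ?thesis by (metis det_I det_mul mult_zero_left zero_neq_one)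
  qed
  have "continuous_on {0..\<theta>} (\<lambda>\<tau>. V 0 \<tau> *v w)" for w
  proof -
    let ?f = "\<lambda>\<tau>. \<chi> k. det (\<chi> i j. if j = k then w $ i else V \<tau> 0 $ i $ j) / det (V \<tau> 0)"
    have eq: "V 0 \<tau> *v w = ?f \<tau>" if "\<tau> \<in> {0..\<theta>}" for \<tau>
    proof -
      have "V \<tau> 0 *v (V 0 \<tau> *v w) = w"
        using transition_matrix_compose[OF V A that 0 that] id that
        by (simp add: matrix_vector_mul_assoc)
      then show ?thesis using cramer[OF det[OF that]] by blast
    qed
    have e: "continuous_on {0..\<theta>} (\<lambda>\<tau>. if j = k then w $ i else V \<tau> 0 $ i $ j)" for i j k
      by (cases "j = k") (simp_all add: continuous_on_component[OF continuous_on_component[OF cV]])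
    have "continuous_on {0..\<theta>} ?f"
      by (intro continuous_on_vec_lambda continuous_on_divide continuous_on_det ballI det)
         (simp_all add: e continuous_on_component[OF continuous_on_component[OF cV]])
    then show ?thesis by (subst continuous_on_cong[OF refl eq])
  qed
  then have *: "continuous_on {0..\<theta>} (\<lambda>\<tau>. V \<theta> 0 *v (V 0 \<tau> *v w))" for w
    by (rule bounded_linear.continuous_on[OF matrix_vector_mul_bounded_linear])
  have eq: "V \<theta> \<tau> $ i $ j = (V \<theta> 0 *v (V 0 \<tau> *v axis j 1)) $ i" if "\<tau> \<in> {0..\<theta>}" for i j \<tau>
    by (simp only: matrix_vector_mul_assoc transition_matrix_compose[OF V A \<theta> 0 that])
       (simp add: matrix_vector_mult_basis column_def)
  have "continuous_on {0..\<theta>} (\<lambda>\<tau>. V \<theta> \<tau> $ i $ j)" for i j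
    by (subst continuous_on_cong[OF refl eq]) (auto intro: continuous_on_component *)
  then have "continuous_on {0..\<theta>} (\<lambda>\<tau>. \<chi> i j. V \<theta> \<tau> $ i $ j)"
    by (intro continuous_on_vec_lambda)
  then show ?thesis by simp
qed

section \<open>Square-integrable controls\<close>

text \<open>On an interval of finite length this crude bound turns square integrability into
  integrability.\<close>

lemma le_one_plus_power2: "(a::real) \<le> 1 + a\<^sup>2"
  using zero_le_power2[of "a - 1/2"] by (simp add: power2_eq_square algebra_simps)

lemma L2_space_imp_integrable:
  fixes u :: "real \<Rightarrow> 'a::euclidean_space"
  assumes "u \<in> L2_space \<theta>"
  shows "integrable (lebesgue_on {0..\<theta>}) u"
proof -
  interpret finite_measure "lebesgue_on {0..\<theta>}" by (rule finite_measure_lebesgue_on) simp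
  show ?thesis
  proof (rule Bochner_Integration.integrable_bound)
    show "integrable (lebesgue_on {0..\<theta>}) (\<lambda>t. 1 + (norm (u t))\<^sup>2)"
      using assms unfolding L2_space_def by auto
    show "AE t in lebesgue_on {0..\<theta>}. norm (u t) \<le> norm (1 + (norm (u t))\<^sup>2)"
      using le_one_plus_power2 abs_ge_self order_trans unfolding real_norm_def by (intro AE_I2) blast
  qed (use assms in \<open>simp add: L2_space_def\<close>)
qed

lemma L2_space_linear_combination:
  fixes a b :: "real \<Rightarrow> 'a::euclidean_space"
  assumes a: "a \<in> L2_space \<theta>" and b: "b \<in> L2_space \<theta>"
  shows "(\<lambda>t. \<alpha> *\<^sub>R a t + \<beta> *\<^sub>R b t) \<in> L2_space \<theta>"
proof -
  have m[measurable]: "a \<in> borel_measurable (lebesgue_on {0..\<theta>})" "b \<in> borel_measurable (lebesgue_on {0..\<theta>})"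
    using a b unfolding L2_space_def by auto
  have sq: "(norm (\<alpha> *\<^sub>R x + \<beta> *\<^sub>R y))\<^sup>2 \<le> 2 * \<alpha>\<^sup>2 * (norm x)\<^sup>2 + 2 * \<beta>\<^sup>2 * (norm y)\<^sup>2" for x y :: 'a
  proof -
    have "(norm (\<alpha> *\<^sub>R x + \<beta> *\<^sub>R y))\<^sup>2 \<le> (\<bar>\<alpha>\<bar> * norm x + \<bar>\<beta>\<bar> * norm y)\<^sup>2"
      using norm_triangle_ineq[of "\<alpha> *\<^sub>R x" "\<beta> *\<^sub>R y"] by (intro power_mono) auto
    also have "\<dots> \<le> 2 * (\<bar>\<alpha>\<bar> * norm x)\<^sup>2 + 2 * (\<bar>\<beta>\<bar> * norm y)\<^sup>2"
      using sum_squares_bound[of "\<bar>\<alpha>\<bar> * norm x" "\<bar>\<beta>\<bar> * norm y"] by (simp add: power2_sum)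
    finally show ?thesis by (simp add: power_mult_distrib)
  qed
  have "integrable (lebesgue_on {0..\<theta>}) (\<lambda>t. (norm (\<alpha> *\<^sub>R a t + \<beta> *\<^sub>R b t))\<^sup>2)"
  proof (rule Bochner_Integration.integrable_bound)
    show "integrable (lebesgue_on {0..\<theta>}) (\<lambda>t. 2 * \<alpha>\<^sup>2 * (norm (a t))\<^sup>2 + 2 * \<beta>\<^sup>2 * (norm (b t))\<^sup>2)"
      using a b unfolding L2_space_def by auto
    show "AE t in lebesgue_on {0..\<theta>}. norm ((norm (\<alpha> *\<^sub>R a t + \<beta> *\<^sub>R b t))\<^sup>2)
        \<le> norm (2 * \<alpha>\<^sup>2 * (norm (a t))\<^sup>2 + 2 * \<beta>\<^sup>2 * (norm (b t))\<^sup>2)"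
      using sq by (intro AE_I2) simp
  qed measurable
  then show ?thesis unfolding L2_space_def by simp
qed

lemma controls_convex_combination:
  fixes a b :: "real \<Rightarrow> 'a::euclidean_space"
  assumes "convex P" "a \<in> controls \<theta> P" "b \<in> controls \<theta> P" "\<alpha> \<in> {0..1}"
  shows "(\<lambda>t. \<alpha> *\<^sub>R a t + (1 - \<alpha>) *\<^sub>R b t) \<in> controls \<theta> P"
  using assms L2_space_linear_combination[of a \<theta> b \<alpha> "1 - \<alpha>"]
  unfolding controls_def by (auto intro!: convexD)

lemma measurable_bounded_matrix_vector_mult:
  fixes K :: "real \<Rightarrow> real^'p^'n"
  assumes K: "continuous_on {a..b} K"
  obtains M where "0 \<le> M"
    "\<And>u. u \<in> borel_measurable (lebesgue_on {a..b}) \<Longrightarrow>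
       (\<lambda>t. K t *v u t) \<in> borel_measurable (lebesgue_on {a..b})"
    "\<And>t w. t \<in> {a..b} \<Longrightarrow> norm (K t *v w) \<le> M * norm w"
proof -
  interpret mv: bounded_bilinear "(*v) :: real^'p^'n \<Rightarrow> real^'p \<Rightarrow> real^'n"
    by (rule bounded_bilinear_matrix_vector_mult)
  obtain c where c: "0 \<le> c" "\<And>M w. norm (M *v w :: real^'n) \<le> norm (M :: real^'p^'n) * norm w * c"
    using mv.nonneg_bounded by blast
  obtain R where R: "0 < R" "\<And>t. t \<in> {a..b} \<Longrightarrow> norm (K t) \<le> R"
    using compact_imp_bounded[OF compact_continuous_image[OF K compact_Icc]]
    unfolding bounded_pos by blast
  show thesis
  proof
    show "0 \<le> R * c" using R c by simp
    show "(\<lambda>t. K t *v u t) \<in> borel_measurable (lebesgue_on {a..b})"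
      if "u \<in> borel_measurable (lebesgue_on {a..b})" for u
      using continuous_imp_measurable_on_sets_lebesgue[OF K] that
      by (intro borel_measurable_continuous_Pair[of K _ u "(*v)"] mv.continuous_on continuous_intros) auto
    show "norm (K t *v w) \<le> R * c * norm w" if "t \<in> {a..b}" for t w
    proof -
      have "norm (K t) * norm w * c \<le> R * norm w * c"
        using R(2)[OF that] c(1) by (intro mult_right_mono) auto
      then show ?thesis using c(2)[of "K t" w] by (simp add: algebra_simps)
    qed
  qed
qed

text \<open>The Bochner integral of a non-integrable function is 0 by default, so
  \<open>endpoint_op\<close> can be treated as linear only once its integrand is known to be
  integrable.\<close>

lemma endpoint_integrand:
  fixes V :: "real \<Rightarrow> real \<Rightarrow> real^'n^'n" and B :: "real \<Rightarrow> real^'p^'n"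
  assumes "transition_matrix \<theta> A V" "continuous_on {0..\<theta>} A" "0 < \<theta>" "continuous_on {0..\<theta>} B"
  obtains M where "0 \<le> M"
    "\<And>u. u \<in> L2_space \<theta> \<Longrightarrow> integrable (lebesgue_on {0..\<theta>}) (\<lambda>\<tau>. V \<theta> \<tau> *v (B \<tau> *v u \<tau>))"
    "\<And>\<tau> w. \<tau> \<in> {0..\<theta>} \<Longrightarrow> norm (V \<theta> \<tau> *v (B \<tau> *v w)) \<le> M * norm w"
proof -
  obtain M1 where M1: "0 \<le> M1"
    "\<And>u. u \<in> borel_measurable (lebesgue_on {0..\<theta>}) \<Longrightarrow>
       (\<lambda>t. V \<theta> t *v u t) \<in> borel_measurable (lebesgue_on {0..\<theta>})"
    "\<And>t w. t \<in> {0..\<theta>} \<Longrightarrow> norm (V \<theta> t *v w) \<le> M1 * norm w"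
    using measurable_bounded_matrix_vector_mult[OF continuous_on_transition_matrix[OF assms(1-3)]] by blast
  obtain M2 where M2: "0 \<le> M2"
    "\<And>u. u \<in> borel_measurable (lebesgue_on {0..\<theta>}) \<Longrightarrow>
       (\<lambda>t. B t *v u t) \<in> borel_measurable (lebesgue_on {0..\<theta>})"
    "\<And>t w. t \<in> {0..\<theta>} \<Longrightarrow> norm (B t *v w) \<le> M2 * norm w"
    using measurable_bounded_matrix_vector_mult[OF assms(4)] by blast
  have bound: "norm (V \<theta> \<tau> *v (B \<tau> *v w)) \<le> M1 * M2 * norm w" if "\<tau> \<in> {0..\<theta>}" for \<tau> w
    using M1(3)[OF that, of "B \<tau> *v w"] mult_left_mono[OF M2(3)[OF that, of w] M1(1)] by simp
  show thesis
  proof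
    show "0 \<le> M1 * M2" using M1(1) M2(1) by simp
    show "integrable (lebesgue_on {0..\<theta>}) (\<lambda>\<tau>. V \<theta> \<tau> *v (B \<tau> *v u \<tau>))" if u: "u \<in> L2_space \<theta>" for u
    proof (rule Bochner_Integration.integrable_bound)
      show "integrable (lebesgue_on {0..\<theta>}) (\<lambda>\<tau>. M1 * M2 * norm (u \<tau>))"
        using L2_space_imp_integrable[OF u] by auto
      show "AE \<tau> in lebesgue_on {0..\<theta>}. norm (V \<theta> \<tau> *v (B \<tau> *v u \<tau>)) \<le> norm (M1 * M2 * norm (u \<tau>))"
        using bound M1(1) M2(1) by (intro AE_I2) (simp add: abs_mult)
      show "(\<lambda>\<tau>. V \<theta> \<tau> *v (B \<tau> *v u \<tau>)) \<in> borel_measurable (lebesgue_on {0..\<theta>})"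
        using u by (intro M1(2) M2(2)) (simp add: L2_space_def)
    qed
  qed (fact bound)
qed

text \<open>It makes the constraint residual of the averaged point the average of the
  residuals.\<close>

lemma endpoint_op_scaleR_sum:
  fixes V :: "real \<Rightarrow> real \<Rightarrow> real^'n^'n" and B :: "real \<Rightarrow> real^'p^'n"
  assumes "transition_matrix \<theta> A V" "continuous_on {0..\<theta>} A" "0 < \<theta>" "continuous_on {0..\<theta>} B"
    and "\<And>i. i \<in> I \<Longrightarrow> u i \<in> L2_space \<theta>"
  shows "endpoint_op \<theta> V B (\<lambda>t. c *\<^sub>R (\<Sum>i\<in>I. u i t)) = c *\<^sub>R (\<Sum>i\<in>I. endpoint_op \<theta> V B (u i))"
proof -
  have int: "integrable (lebesgue_on {0..\<theta>}) (\<lambda>\<tau>. V \<theta> \<tau> *v (B \<tau> *v u i \<tau>))" if "i \<in> I" for i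
    using endpoint_integrand[OF assms(1-4)] assms(5)[OF that] by metis
  have "V \<theta> \<tau> *v (B \<tau> *v (c *\<^sub>R (\<Sum>i\<in>I. u i \<tau>))) = c *\<^sub>R (\<Sum>i\<in>I. V \<theta> \<tau> *v (B \<tau> *v u i \<tau>))" for \<tau>
    by (simp add: matrix_vector_mult_scaleR linear_sum[OF matrix_vector_mul_linear])
  then show ?thesis unfolding endpoint_op_def using int
    by (simp add: Bochner_Integration.integral_sum)
qed

text \<open>A real \<open>Sup\<close> may have any sign on an unbounded set, so boundedness has to
  be shown first; then 0, attained at zero arguments, lies below the supremum. The sign is what
  permits adding this factor to the diameters in \<open>Llam\<close> and \<open>Lmu\<close>.\<close>

lemma L2_op_norm_endpoint_op_nonneg:
  fixes V :: "real \<Rightarrow> real \<Rightarrow> real^'n^'n" and B :: "real \<Rightarrow> real^'p^'n"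
  assumes N: "is_norm N"
    and V: "transition_matrix \<theta> A V" "continuous_on {0..\<theta>} A" "0 < \<theta>" "continuous_on {0..\<theta>} B"
  shows "0 \<le> L2_op_norm N \<theta> (endpoint_op \<theta> V B)"
proof -
  let ?S = "{m \<bullet> endpoint_op \<theta> V B u | m u. N m \<le> 1 \<and> u \<in> L2_space \<theta> \<and> l2_norm \<theta> u \<le> 1}"
  interpret finite_measure "lebesgue_on {0..\<theta>}" by (rule finite_measure_lebesgue_on) simp
  obtain c where c: "0 < c" "\<And>x. norm x \<le> c * N x" using norm_le_is_norm[OF N] by blast
  obtain M where M: "0 \<le> M"
    "\<And>u. u \<in> L2_space \<theta> \<Longrightarrow> integrable (lebesgue_on {0..\<theta>}) (\<lambda>\<tau>. V \<theta> \<tau> *v (B \<tau> *v u \<tau>))"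
    "\<And>\<tau> w. \<tau> \<in> {0..\<theta>} \<Longrightarrow> norm (V \<theta> \<tau> *v (B \<tau> *v w)) \<le> M * norm w"
    using endpoint_integrand[OF V] by blast
  \<comment> \<open>The integrand is at most M(1 + |u|^2), whose integral is M times \<theta> plus
    the squared L2 norm; \<open>c\<close> bounds the Euclidean length of \<open>m\<close>.\<close>
  have bound: "m \<bullet> endpoint_op \<theta> V B u \<le> c * (M * (\<theta> + 1))"
    if m: "N m \<le> 1" and u: "u \<in> L2_space \<theta>" "l2_norm \<theta> u \<le> 1" for m u
  proof -
    have u2: "integrable (lebesgue_on {0..\<theta>}) (\<lambda>t. (norm (u t))\<^sup>2)"
      using u(1) unfolding L2_space_def by simp
    have "norm m \<le> c" using c m by (meson mult_left_le less_imp_le order_trans)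
    have le1: "integral\<^sup>L (lebesgue_on {0..\<theta>}) (\<lambda>t. (norm (u t))\<^sup>2) \<le> 1"
      using u(2) unfolding l2_norm_def by simp
    have "norm (endpoint_op \<theta> V B u) \<le> integral\<^sup>L (lebesgue_on {0..\<theta>}) (\<lambda>t. norm (V \<theta> t *v (B t *v u t)))"
      unfolding endpoint_op_def by (rule integral_norm_bound)
    also have "\<dots> \<le> integral\<^sup>L (lebesgue_on {0..\<theta>}) (\<lambda>t. M * (1 + (norm (u t))\<^sup>2))"
    proof (rule integral_mono)
      fix t assume "t \<in> space (lebesgue_on {0..\<theta>})"
      then show "norm (V \<theta> t *v (B t *v u t)) \<le> M * (1 + (norm (u t))\<^sup>2)"
        using M(3)[of t "u t"] mult_left_mono[OF le_one_plus_power2[of "norm (u t)"] M(1)] by auto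
    qed (use M(2)[OF u(1)] u2 in auto)
    also have "\<dots> = M * (\<theta> + integral\<^sup>L (lebesgue_on {0..\<theta>}) (\<lambda>t. (norm (u t))\<^sup>2))"
      using u2 \<open>0 < \<theta>\<close> by (simp add: measure_restrict_space)
    also have "\<dots> \<le> M * (\<theta> + 1)" using M(1) le1 by (intro mult_left_mono) auto
    finally have "norm m * norm (endpoint_op \<theta> V B u) \<le> c * (M * (\<theta> + 1))"
      using \<open>norm m \<le> c\<close> c(1) by (intro mult_mono) auto
    then show ?thesis using norm_cauchy_schwarz order_trans by blast
  qed
  have "bdd_above ?S" using bound by (intro bdd_aboveI[of _ "c * (M * (\<theta> + 1))"]) blast
  moreover have "N 0 = 0" using N by (simp add: is_norm_def)
  then have "0 \<in> ?S"
    by (auto simp: L2_space_def l2_norm_def intro!: exI[of _ 0] exI[of _ "\<lambda>_. 0"])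
  ultimately show ?thesis unfolding L2_op_norm_def by (rule cSup_upper[rotated])
qed

section \<open>Averages\<close>

text \<open>Jensen's inequality by induction: the average of k + 2 controls is a convex combination
  of the average of the first k + 1, with weight (k + 1)/(k + 2), and the last one. Membership in
  \<open>U\<close> is carried along because convexity is applied at the previous average.\<close>

lemma functional_convex_on_average:
  fixes w :: "nat \<Rightarrow> real \<Rightarrow> 'a::real_vector"
  assumes f: "functional_convex_on U f"
    and U: "\<And>a b \<alpha>. a \<in> U \<Longrightarrow> b \<in> U \<Longrightarrow> \<alpha> \<in> {0..1} \<Longrightarrow> (\<lambda>t. \<alpha> *\<^sub>R a t + (1 - \<alpha>) *\<^sub>R b t) \<in> U"
    and w: "\<And>i. w i \<in> U"
  shows "(\<lambda>t. (1 / (real k + 1)) *\<^sub>R (\<Sum>i=0..k. w i t)) \<in> U \<and>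
    f (\<lambda>t. (1 / (real k + 1)) *\<^sub>R (\<Sum>i=0..k. w i t)) \<le> (\<Sum>i=0..k. f (w i)) / (real k + 1)"
proof (induction k)
  case 0
  then show ?case using w by simp
next
  case (Suc k)
  let ?a = "\<lambda>t. (1 / (real k + 1)) *\<^sub>R (\<Sum>i=0..k. w i t)"
  define \<alpha> where "\<alpha> = (real k + 1) / (real k + 2)"
  have \<alpha>: "\<alpha> \<in> {0..1}" "1 - \<alpha> = 1 / (real k + 2)" "\<alpha> * (1 / (real k + 1)) = 1 / (real k + 2)"
    unfolding \<alpha>_def by (auto simp: field_simps)
  have eq: "(\<lambda>t. (1 / (real (Suc k) + 1)) *\<^sub>R (\<Sum>i=0..Suc k. w i t))
      = (\<lambda>t. \<alpha> *\<^sub>R ?a t + (1 - \<alpha>) *\<^sub>R w (Suc k) t)"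
    unfolding scaleR_scaleR \<alpha>(2,3) by (simp add: scaleR_add_right add.commute)
  have "f (\<lambda>t. \<alpha> *\<^sub>R ?a t + (1 - \<alpha>) *\<^sub>R w (Suc k) t) \<le> \<alpha> * f ?a + (1 - \<alpha>) * f (w (Suc k))"
    using f[unfolded functional_convex_on_def, rule_format, of ?a "w (Suc k)" \<alpha>] Suc w \<alpha>(1) by auto
  also have "\<dots> \<le> \<alpha> * ((\<Sum>i=0..k. f (w i)) / (real k + 1)) + (1 - \<alpha>) * f (w (Suc k))"
    using Suc \<alpha>(1) by (intro add_right_mono mult_left_mono) auto
  also have "\<dots> = (\<alpha> * (1 / (real k + 1))) * (\<Sum>i=0..k. f (w i)) + (1 - \<alpha>) * f (w (Suc k))"
    by simp
  also have "\<dots> = (\<Sum>i=0..Suc k. f (w i)) / (real (Suc k) + 1)"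
    unfolding \<alpha>(2,3) by (simp add: add_divide_distrib add.commute)
  finally show ?case unfolding eq using U[OF conjunct1[OF Suc] w \<alpha>(1)] by blast
qed

lemma convex_on_average:
  fixes x :: "nat \<Rightarrow> 'a::real_vector"
  assumes "convex_on S f" "\<And>i. x i \<in> S"
  shows "f ((1 / (real k + 1)) *\<^sub>R (\<Sum>i=0..k. x i)) \<le> (\<Sum>i=0..k. f (x i)) / (real k + 1)"
  using convex_on_sum[of "{0..k}" S f "\<lambda>_. 1 / (real k + 1)" x] assms
  by (simp add: scaleR_sum_right sum_divide_distrib)

lemma convex_average:
  fixes x :: "nat \<Rightarrow> 'a::real_vector"
  assumes "convex S" "\<And>i. x i \<in> S"
  shows "(1 / (real k + 1)) *\<^sub>R (\<Sum>i=0..k. x i) \<in> S"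
  using convex_sum[of "{0..k}" S "\<lambda>_. 1 / (real k + 1)" x] assms
  by (simp add: scaleR_sum_right)

section \<open>Saddle values\<close>

text \<open>A saddle point makes the extended-real value finite, so that inequalities between values
  of \<psi> can be read in the reals.\<close>

lemma minmax_eq_saddle_value:
  assumes "saddle_point f A B a b"
  shows "minmax f A B = ereal (f a b)"
proof (rule antisym)
  have "minmax f A B \<le> (SUP b'\<in>B. ereal (f a b'))"
    using assms unfolding minmax_def saddle_point_def by (intro INF_lower) auto
  also have "\<dots> \<le> ereal (f a b)"
    using assms unfolding saddle_point_def by (intro SUP_least) auto
  finally show "minmax f A B \<le> ereal (f a b)" .
  show "ereal (f a b) \<le> minmax f A B"
    unfolding minmax_def
  proof (rule INF_greatest)
    fix a' assume "a' \<in> A"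
    then have "ereal (f a b) \<le> ereal (f a' b)" using assms unfolding saddle_point_def by auto
    also have "\<dots> \<le> (SUP b'\<in>B. ereal (f a' b'))"
      using assms unfolding saddle_point_def by (intro SUP_upper) auto
    finally show "ereal (f a b) \<le> (SUP b'\<in>B. ereal (f a' b'))" .
  qed
qed

text \<open>Both values are compared with the crossed point \<open>(a', b)\<close>. If
  \<open>f\<close> and \<open>f'\<close> differ only by a change of one multiplier, the correction
  is linear in that change, and this is a partial sub- or supergradient inequality for the saddle
  value.\<close>

lemma saddle_value_le:
  fixes f f' :: "'a \<Rightarrow> 'b \<Rightarrow> real"
  assumes "saddle_point f A B a b" "saddle_point f' A B a' b'"
  shows "f a b \<le> f' a' b' + (f a' b - f' a' b)"
proof -
  have "f a b \<le> f a' b" "f' a' b \<le> f' a' b'"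
    using assms unfolding saddle_point_def by auto
  then show ?thesis by linarith
qed

text \<open>The outer infimum for \<open>G\<close> is bounded above by choosing \<open>l0\<close>,
  the inner supremum for \<open>H\<close> below by choosing \<open>m0\<close>. All other variables
  stay free on the two sides, so the suprema and infima can be taken one after the other.\<close>

lemma SUP_minmax_diff_INF_minmax_le:
  assumes le: "\<And>s t l m. s \<in> S \<Longrightarrow> t \<in> T \<Longrightarrow> l \<in> A \<Longrightarrow> m \<in> B \<Longrightarrow> G s l0 m \<le> H t l m0 + \<epsilon>"
    and mem: "l0 \<in> A" "m0 \<in> B" and ne: "S \<noteq> {}" "T \<noteq> {}"
  shows "(SUP s\<in>S. minmax (G s) A B) - (INF t\<in>T. minmax (H t) A B) \<le> ereal \<epsilon>"
proof -
  let ?P = "SUP s\<in>S. minmax (G s) A B" and ?Q = "INF t\<in>T. minmax (H t) A B"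
  have P: "?P \<le> ereal c" if c: "\<And>s m. s \<in> S \<Longrightarrow> m \<in> B \<Longrightarrow> G s l0 m \<le> c" for c
  proof (rule SUP_least)
    fix s assume s: "s \<in> S"
    have "minmax (G s) A B \<le> (SUP m\<in>B. ereal (G s l0 m))"
      unfolding minmax_def by (rule INF_lower) fact
    also have "\<dots> \<le> ereal c" using c[OF s] by (intro SUP_least) auto
    finally show "minmax (G s) A B \<le> ereal c" .
  qed
  have Q: "c \<le> ?Q" if c: "\<And>t l. t \<in> T \<Longrightarrow> l \<in> A \<Longrightarrow> c \<le> ereal (H t l m0)" for c
  proof (rule INF_greatest)
    fix t assume t: "t \<in> T"
    show "c \<le> minmax (H t) A B" unfolding minmax_def
    proof (rule INF_greatest)
      fix l assume "l \<in> A"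
      then have "c \<le> ereal (H t l m0)" using c[OF t] by blast
      also have "\<dots> \<le> (SUP m\<in>B. ereal (H t l m))" by (rule SUP_upper) fact
      finally show "c \<le> (SUP m\<in>B. ereal (H t l m))" .
    qed
  qed
  obtain s0 t0 where "s0 \<in> S" "t0 \<in> T" using ne by auto
  \<comment> \<open>These two exclusions rule out an extended-real difference of the form infinity
    minus infinity; nonemptiness of \<open>S\<close> and \<open>T\<close> provides the real
    bounds.\<close>
  have "?P \<noteq> \<infinity>" using P[of "H t0 l0 m0 + \<epsilon>"] le[OF _ \<open>t0 \<in> T\<close> mem(1)] by auto
  moreover have "ereal (G s0 l0 m0 - \<epsilon>) \<le> ?Q"
    using le[OF \<open>s0 \<in> S\<close> _ _ mem(2)] by (intro Q) (auto simp: algebra_simps)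
  then have "?Q \<noteq> - \<infinity>" by auto
  moreover have "?P - ereal \<epsilon> \<le> ?Q"
  proof (rule Q)
    fix t l assume "t \<in> T" "l \<in> A"
    then have "?P \<le> ereal (H t l m0 + \<epsilon>)" using le by (intro P) blast
    then show "?P - ereal \<epsilon> \<le> ereal (H t l m0)" by (simp add: ereal_minus_le_iff add.commute)
  qed
  then have "?P \<le> ?Q + ereal \<epsilon>" by (simp add: ereal_minus_le_iff add.commute)
  ultimately show ?thesis by (auto simp: ereal_minus_le_iff add.commute)
qed

section \<open>The averaged iterates\<close>

theorem theorem3p1:
  fixes \<theta> :: real
    and Ax :: "real \<Rightarrow> real^'n^'n" and B :: "real \<Rightarrow> real^'p^'n"
    and Ay :: "real \<Rightarrow> real^'m^'m" and C :: "real \<Rightarrow> real^'q^'m"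
    and Vx :: "real \<Rightarrow> real \<Rightarrow> real^'n^'n" and Vy :: "real \<Rightarrow> real \<Rightarrow> real^'m^'m"
    and x0 xt0 :: "real^'n" and y0 yt0 :: "real^'m"
    and P :: "(real^'p) set" and Q :: "(real^'q) set"
    and X :: "(real^'n) set" and Y :: "(real^'m) set"
    and UU :: "(real \<Rightarrow> real^'p) set" and VV :: "(real \<Rightarrow> real^'q) set"
    and Ftilde :: "real \<Rightarrow> real^'p \<Rightarrow> real^'q \<Rightarrow> real"
    and F :: "(real \<Rightarrow> real^'p) \<Rightarrow> (real \<Rightarrow> real^'q) \<Rightarrow> real"
    and \<Phi> :: "real^'n \<Rightarrow> real^'m \<Rightarrow> real"
    and Bop :: "(real \<Rightarrow> real^'p) \<Rightarrow> real^'n" and Cop :: "(real \<Rightarrow> real^'q) \<Rightarrow> real^'m"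
    and f1 :: "real^'m \<Rightarrow> real^'n \<Rightarrow> (real \<Rightarrow> real^'p) \<Rightarrow> (real \<Rightarrow> real^'q) \<Rightarrow> real"
    and f2 :: "real^'m \<Rightarrow> real^'n \<Rightarrow> real^'n \<Rightarrow> real^'m \<Rightarrow> real"
    and \<psi>1 \<psi>2 \<psi> :: "real^'m \<Rightarrow> real^'n \<Rightarrow> ereal"
    and Nlam dlam :: "real^'m \<Rightarrow> real" and Nmu dmu :: "real^'n \<Rightarrow> real"
    and d :: "(real^'m) \<times> (real^'n) \<Rightarrow> real"
    and lam0 lamstar :: "real^'m" and mu0 mustar :: "real^'n"
    and \<sigma>lam \<sigma>mu \<kappa> \<gamma> r Llam Lmu L Dlam Dmu D :: real
    and u :: "nat \<Rightarrow> real \<Rightarrow> real^'p" and v :: "nat \<Rightarrow> real \<Rightarrow> real^'q"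
    and x :: "nat \<Rightarrow> real^'n" and y :: "nat \<Rightarrow> real^'m"
    and lam :: "nat \<Rightarrow> real^'m" and mu :: "nat \<Rightarrow> real^'n"
    and g s :: "nat \<Rightarrow> (real^'m) \<times> (real^'n)"
    and \<phi> :: "(real \<Rightarrow> real^'p) \<Rightarrow> real^'n \<Rightarrow> (real \<Rightarrow> real^'q) \<Rightarrow> real^'m \<Rightarrow> ereal"
    and \<xi> :: "(real \<Rightarrow> real^'p) \<Rightarrow> real^'n \<Rightarrow> ereal"
    and \<eta> :: "(real \<Rightarrow> real^'q) \<Rightarrow> real^'m \<Rightarrow> ereal"
    and uhat :: "nat \<Rightarrow> real \<Rightarrow> real^'p" and vhat :: "nat \<Rightarrow> real \<Rightarrow> real^'q"
    and xhat :: "nat \<Rightarrow> real^'n" and yhat :: "nat \<Rightarrow> real^'m"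
    and k :: nat
    (* the differential game *)
  assumes "0 < \<theta>"
    and "continuous_on {0..\<theta>} Ax" and "continuous_on {0..\<theta>} B"
    and "continuous_on {0..\<theta>} Ay" and "continuous_on {0..\<theta>} C"
    and "closed P" and "convex P" and "closed Q" and "convex Q"
    and UU: "UU = controls \<theta> P" and VV: "VV = controls \<theta> Q"
    and F_integrable: "\<forall>u\<in>UU. \<forall>v\<in>VV. integrable (lebesgue_on {0..\<theta>}) (\<lambda>\<tau>. Ftilde \<tau> (u \<tau>) (v \<tau>))"
    and F: "F = (\<lambda>u v. integral\<^sup>L (lebesgue_on {0..\<theta>}) (\<lambda>\<tau>. Ftilde \<tau> (u \<tau>) (v \<tau>)))"
    and F_usc: "\<forall>u\<in>UU. L2_upper_semicontinuous_on \<theta> VV (\<lambda>v. F u v)"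
    and F_lsc: "\<forall>v\<in>VV. L2_lower_semicontinuous_on \<theta> UU (\<lambda>u. F u v)"
    and "transition_matrix \<theta> Ax Vx" and "transition_matrix \<theta> Ay Vy"
    and Bop: "Bop = endpoint_op \<theta> Vx B" and xt0: "xt0 = Vx \<theta> 0 *v x0"
    and Cop: "Cop = endpoint_op \<theta> Vy C" and yt0: "yt0 = Vy \<theta> 0 *v y0"
    and "closed X" and "convex X" and "bounded X" and reach_X: "\<forall>u\<in>UU. xt0 + Bop u \<in> X"
    and "closed Y" and "convex Y" and "bounded Y" and reach_Y: "\<forall>v\<in>VV. yt0 + Cop v \<in> Y"
    and \<Phi>_cont: "continuous_on (X \<times> Y) (\<lambda>(x, y). \<Phi> x y)"
    and game_saddle: "\<exists>u v. saddle_point (\<lambda>u v. F u v + \<Phi> (xt0 + Bop u) (yt0 + Cop v)) UU VV u v"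
    (* the conjugate problem *)
    and f1: "f1 = (\<lambda>l m u v. F u v - m \<bullet> Bop u + l \<bullet> Cop v)"
    and f2: "f2 = (\<lambda>l m x y. \<Phi> x y + m \<bullet> x - l \<bullet> y)"
    and f1_solvable: "\<forall>l m. \<exists>u v. saddle_point (f1 l m) UU VV u v"
    and f2_solvable: "\<forall>l m. \<exists>x y. saddle_point (f2 l m) X Y x y"
    and \<psi>1: "\<psi>1 = (\<lambda>l m. minmax (f1 l m) UU VV)"
    and \<psi>2: "\<psi>2 = (\<lambda>l m. minmax (f2 l m) X Y)"
    and \<psi>: "\<psi> = (\<lambda>l m. \<psi>1 l m + \<psi>2 l m - ereal (m \<bullet> xt0) + ereal (l \<bullet> yt0))"
    and conj_saddle: "saddle_point \<psi> UNIV UNIV lamstar mustar"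
    (* norms and prox-functions *)
    and "is_norm Nlam" and "is_norm Nmu"
    and "prox_function Nlam \<sigma>lam dlam lam0" and "prox_function Nmu \<sigma>mu dmu mu0"
    and "0 < \<kappa>" and "\<kappa> < 1"
    and d: "d = (\<lambda>(l, m). \<kappa> * dlam l + (1 - \<kappa>) * dmu m)"
    and Llam: "Llam = sqrt \<theta> * L2_op_norm Nlam \<theta> Cop * diameter Q
                 + diam_wrt (dual_norm Nlam) Y + dual_norm Nlam yt0"
    and Lmu: "Lmu = sqrt \<theta> * L2_op_norm Nmu \<theta> Bop * diameter P
                 + diam_wrt (dual_norm Nmu) X + dual_norm Nmu xt0"
    and L: "L\<^sup>2 = Llam\<^sup>2 / (\<kappa> * \<sigma>lam) + Lmu\<^sup>2 / ((1 - \<kappa>) * \<sigma>mu)"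
    (* the method *)
    and "0 < \<gamma>"
    and uv: "\<forall>i. saddle_point (f1 (lam i) (mu i)) UU VV (u i) (v i)"
    and xy: "\<forall>i. saddle_point (f2 (lam i) (mu i)) X Y (x i) (y i)"
    and g: "\<forall>i. g i = (Cop (v i) + yt0 - y i, - (x i - xt0 - Bop (u i)))"
    and M1: "simple_dual_averages \<gamma> d (lam0, mu0) g s (\<lambda>i. (lam i, mu i))"
    and z_bounded: "bounded (range (\<lambda>i. (lam i, mu i)))"
    (* the constants D and r *)
    and Dlam: "\<forall>i. dlam (lam i) \<le> Dlam" and Dmu: "\<forall>i. dmu (mu i) \<le> Dmu"
    and "0 < r"
    and ball_lam: "{l. Nlam (l - lamstar) \<le> r / sqrt (\<kappa> * \<sigma>lam)} \<subseteq> {l. dlam l \<le> Dlam}"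
    and ball_mu: "{m. Nmu (m - mustar) \<le> r / sqrt ((1 - \<kappa>) * \<sigma>mu)} \<subseteq> {m. dmu m \<le> Dmu}"
    and D: "D = \<kappa> * Dlam + (1 - \<kappa>) * Dmu"
    (* the gap functions *)
    and \<phi>: "\<phi> = (\<lambda>u x v y. minmax
               (\<lambda>l m. F u v + \<Phi> x y + m \<bullet> (x - xt0 - Bop u) + l \<bullet> (Cop v + yt0 - y))
               {l. dlam l \<le> Dlam} {m. dmu m \<le> Dmu})"
    and \<xi>: "\<xi> = (\<lambda>u x. SUP (v, y)\<in>VV \<times> Y. \<phi> u x v y)"
    and \<eta>: "\<eta> = (\<lambda>v y. INF (u, x)\<in>UU \<times> X. \<phi> u x v y)"
    (* the averaged points *)
    and uhat: "\<forall>j. uhat (Suc j) = (\<lambda>t. (1 / (real j + 1)) *\<^sub>R (\<Sum>i=0..j. u i t))"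
    and vhat: "\<forall>j. vhat (Suc j) = (\<lambda>t. (1 / (real j + 1)) *\<^sub>R (\<Sum>i=0..j. v i t))"
    and xhat: "\<forall>j. xhat (Suc j) = (1 / (real j + 1)) *\<^sub>R (\<Sum>i=0..j. x i)"
    and yhat: "\<forall>j. yhat (Suc j) = (1 / (real j + 1)) *\<^sub>R (\<Sum>i=0..j. y i)"
    (* (A1) and (A2) *)
    and A1: "bounded P" "bounded Q"
    and A2: "\<forall>v\<in>VV. functional_convex_on UU (\<lambda>u. F u v)"
            "\<forall>u\<in>UU. functional_concave_on VV (\<lambda>v. F u v)"
            "\<forall>y\<in>Y. convex_on X (\<lambda>x. \<Phi> x y)"
            "\<forall>x\<in>X. concave_on Y (\<lambda>y. \<Phi> x y)"
  shows "\<xi> (uhat (Suc k)) (xhat (Suc k)) - \<eta> (vhat (Suc k)) (yhat (Suc k))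
           \<le> ereal (beta_hat (Suc k) / (real k + 1) * (\<gamma> * D + L\<^sup>2 / (2 * \<gamma>)))
       \<and> dual_norm Nmu (xt0 + Bop (uhat (Suc k)) - xhat (Suc k))
           \<le> beta_hat (Suc k) * sqrt \<sigma>mu / (r * (real k + 1)) * (\<gamma> * D + L\<^sup>2 / (2 * \<gamma>))
       \<and> dual_norm Nlam (yt0 + Cop (vhat (Suc k)) - yhat (Suc k))
           \<le> beta_hat (Suc k) * sqrt \<sigma>lam / (r * (real k + 1)) * (\<gamma> * D + L\<^sup>2 / (2 * \<gamma>))"
proof -
  define n where "n = real k + 1"
  define E where "E = beta_hat (Suc k) * (\<gamma> * D + L\<^sup>2 / (2 * \<gamma>))"
  define z where "z = (\<lambda>i. (lam i, mu i))"
  define w where "w = (\<lambda>i. Cop (v i) + yt0 - y i)"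
  define p where "p = (\<lambda>i. x i - xt0 - Bop (u i))"
  define A where "A = {l. dlam l \<le> Dlam}"
  define M where "M = {m. dmu m \<le> Dmu}"
  note Nlam = \<open>is_norm Nlam\<close> and Nmu = \<open>is_norm Nmu\<close>
  have "0 < n" unfolding n_def by simp
  have g': "g i = (w i, - p i)" for i using g unfolding w_def p_def by simp
  have mem: "u i \<in> UU" "v i \<in> VV" "x i \<in> X" "y i \<in> Y" for i
    using uv xy unfolding saddle_point_def by auto
  have \<sigma>: "0 < \<sigma>lam" "0 < \<sigma>mu" and sc: "strongly_convex Nlam \<sigma>lam dlam" "strongly_convex Nmu \<sigma>mu dmu"
    and d_min: "dlam lam0 = 0" "dmu mu0 = 0" "\<And>l. 0 \<le> dlam l" "\<And>m. 0 \<le> dmu m"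
    using \<open>prox_function Nlam \<sigma>lam dlam lam0\<close> \<open>prox_function Nmu \<sigma>mu dmu mu0\<close>
    unfolding prox_function_def is_arg_min_linorder by auto
  have \<kappa>: "0 < \<kappa> * \<sigma>lam" "0 < (1 - \<kappa>) * \<sigma>mu" using \<sigma> \<open>0 < \<kappa>\<close> \<open>\<kappa> < 1\<close> by auto

  \<comment> \<open>Bounds on the partial subgradients\<close>
  have w_le: "dual_norm Nlam (w i) \<le> Llam" for i
  proof -
    have "dual_norm Nlam (w i) \<le> diam_wrt (dual_norm Nlam) Y"
      using dual_norm_diff_le_diam[OF Nlam \<open>bounded Y\<close> _ mem(4), of "yt0 + Cop (v i)" i] reach_Y mem(2)
      unfolding w_def by (simp add: add.commute)
    \<comment> \<open>A nonnegative summand is added to reach \<open>Llam\<close>; boundedness of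
      \<open>Q\<close> makes \<open>diameter Q\<close> nonnegative.\<close>
    moreover have "0 \<le> L2_op_norm Nlam \<theta> Cop"
      unfolding Cop by (rule L2_op_norm_endpoint_op_nonneg) fact+
    then have "0 \<le> sqrt \<theta> * L2_op_norm Nlam \<theta> Cop * diameter Q"
      using \<open>0 < \<theta>\<close> diameter_ge_0[OF A1(2)] by simp
    ultimately show ?thesis
      using dual_norm_nonneg[OF Nlam, of yt0] unfolding Llam by linarith
  qed
  have p_le: "dual_norm Nmu (p i) \<le> Lmu" for i
  proof -
    have "dual_norm Nmu (p i) \<le> diam_wrt (dual_norm Nmu) X"
      using dual_norm_diff_le_diam[OF Nmu \<open>bounded X\<close> mem(3), of "xt0 + Bop (u i)" i] reach_X mem(1)
      unfolding p_def by (simp add: diff_diff_eq)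
    moreover have "0 \<le> L2_op_norm Nmu \<theta> Bop"
      unfolding Bop by (rule L2_op_norm_endpoint_op_nonneg) fact+
    then have "0 \<le> sqrt \<theta> * L2_op_norm Nmu \<theta> Bop * diameter P"
      using \<open>0 < \<theta>\<close> diameter_ge_0[OF A1(1)] by simp
    ultimately show ?thesis
      using dual_norm_nonneg[OF Nmu, of xt0] unfolding Lmu by linarith
  qed
  define Nz where "Nz = (\<lambda>(l, m). sqrt (\<kappa> * \<sigma>lam * (Nlam l)\<^sup>2 + (1 - \<kappa>) * \<sigma>mu * (Nmu m)\<^sup>2))"
  \<comment> \<open>\<open>L\<close> is fixed only through its square, hence the absolute value.
    Dividing and multiplying by the roots \<open>?a\<close> and \<open>?b\<close> and applying
    Cauchy-Schwarz in the plane produces \<open>\<bar>L\<bar>\<close> and the product norm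
    \<open>Nz\<close>.\<close>
  have g_le: "- (g i \<bullet> q) \<le> \<bar>L\<bar> * Nz q" for i q
  proof -
    obtain l m where q: "q = (l, m)" by fastforce
    let ?a = "sqrt (\<kappa> * \<sigma>lam)" and ?b = "sqrt ((1 - \<kappa>) * \<sigma>mu)"
    have N_nonneg: "0 \<le> Nlam l" "0 \<le> Nmu m" using Nlam Nmu by (auto simp: is_norm_def)
    have "- (g i \<bullet> q) = w i \<bullet> (- l) + p i \<bullet> m" unfolding q g' by simp
    also have "\<dots> \<le> dual_norm Nlam (w i) * Nlam l + dual_norm Nmu (p i) * Nmu m"
      using inner_le_dual_norm[OF Nlam, of "w i" "- l"] inner_le_dual_norm[OF Nmu, of "p i" m]
      by (simp add: is_norm_uminus[OF Nlam])
    also have "\<dots> \<le> Llam * Nlam l + Lmu * Nmu m"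
      using w_le p_le N_nonneg by (intro add_mono mult_right_mono) auto
    also have "\<dots> = (Llam / ?a, Lmu / ?b) \<bullet> (?a * Nlam l, ?b * Nmu m)"
      using \<sigma> \<open>0 < \<kappa>\<close> \<open>\<kappa> < 1\<close> by simp
    also have "\<dots> \<le> norm (Llam / ?a, Lmu / ?b) * norm (?a * Nlam l, ?b * Nmu m)"
      by (rule norm_cauchy_schwarz)
    also have "norm (Llam / ?a, Lmu / ?b) = \<bar>L\<bar>"
      using \<sigma> \<open>0 < \<kappa>\<close> \<open>\<kappa> < 1\<close> by (simp add: norm_Pair power_divide L[symmetric])
    also have "norm (?a * Nlam l, ?b * Nmu m) = Nz q"
      using \<sigma> \<open>0 < \<kappa>\<close> \<open>\<kappa> < 1\<close> by (simp add: norm_Pair power_mult_distrib Nz_def q)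
    finally show ?thesis .
  qed

  \<comment> \<open>Regret over the prox-balls\<close>
  have gap: "(\<Sum>i=0..k. g i \<bullet> (z i - (l, m))) \<le> E" if "l \<in> A" "m \<in> M" for l m
  proof -
    have "(\<Sum>i=0..k. g i \<bullet> (z i - (l, m))) \<le> beta_hat (Suc k) * (\<gamma> * d (l, m) + \<bar>L\<bar>\<^sup>2 / (2 * \<gamma>))"
    proof (rule simple_dual_averages_gap[OF M1[folded z_def] \<open>0 < \<gamma>\<close>])
      show "strongly_convex Nz 1 d" unfolding d Nz_def
        using sc \<sigma> \<open>0 < \<kappa>\<close> \<open>\<kappa> < 1\<close> by (intro strongly_convex_Pair) auto
      show "is_arg_min d (\<lambda>_. True) (lam0, mu0)" "d (lam0, mu0) = 0"
        using d_min \<open>0 < \<kappa>\<close> \<open>\<kappa> < 1\<close> unfolding d is_arg_min_linorder by auto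
    qed (fact g_le)
    also have "\<dots> \<le> E"
    proof -
      have "d (l, m) \<le> D"
        using that \<open>0 < \<kappa>\<close> \<open>\<kappa> < 1\<close> unfolding d D A_def M_def by (auto intro!: add_mono mult_left_mono)
      then show ?thesis unfolding E_def using \<open>0 < \<gamma>\<close> less_imp_le[OF beta_hat_pos, of "Suc k"]
        by (intro mult_left_mono add_right_mono) (simp_all del: beta_hat.simps)
    qed
    finally show ?thesis .
  qed
  \<comment> \<open>The iterates themselves lie in the prox-balls, where the prox-functions are
    nonnegative. The resulting sign of \<open>E\<close> is required by
    \<open>dual_norm_scaled_le\<close>.\<close>
  have "0 \<le> D"
    using Dlam Dmu d_min(3)[of "lam 0"] d_min(4)[of "mu 0"] \<open>0 < \<kappa>\<close> \<open>\<kappa> < 1\<close> unfolding D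
    by (smt (verit) mult_nonneg_nonneg)
  then have "0 \<le> E" unfolding E_def using \<open>0 < \<gamma>\<close> beta_hat_pos[of "Suc k"]
    by (intro mult_nonneg_nonneg) (simp_all del: beta_hat.simps)

  \<comment> \<open>Averaged points and their residuals\<close>
  have uhat': "uhat (Suc k) = (\<lambda>t. (1 / n) *\<^sub>R (\<Sum>i=0..k. u i t))"
    and vhat': "vhat (Suc k) = (\<lambda>t. (1 / n) *\<^sub>R (\<Sum>i=0..k. v i t))"
    and xhat': "xhat (Suc k) = (1 / n) *\<^sub>R (\<Sum>i=0..k. x i)"
    and yhat': "yhat (Suc k) = (1 / n) *\<^sub>R (\<Sum>i=0..k. y i)"
    using uhat vhat xhat yhat unfolding n_def by auto
  have cc: "\<And>a b \<alpha>. a \<in> UU \<Longrightarrow> b \<in> UU \<Longrightarrow> \<alpha> \<in> {0..1} \<Longrightarrow> (\<lambda>t. \<alpha> *\<^sub>R a t + (1 - \<alpha>) *\<^sub>R b t) \<in> UU"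
    "\<And>a b \<alpha>. a \<in> VV \<Longrightarrow> b \<in> VV \<Longrightarrow> \<alpha> \<in> {0..1} \<Longrightarrow> (\<lambda>t. \<alpha> *\<^sub>R a t + (1 - \<alpha>) *\<^sub>R b t) \<in> VV"
    unfolding UU VV using controls_convex_combination \<open>convex P\<close> \<open>convex Q\<close> by blast+
  have const: "(1 / n) *\<^sub>R (\<Sum>i=0..k. c) = c" for c :: "'b::real_vector"
    unfolding sum_constant_scaleR n_def by (simp add: add.commute)
  have L2: "u i \<in> L2_space \<theta>" "v i \<in> L2_space \<theta>" for i
    using mem unfolding UU VV controls_def by auto
  have phat: "xhat (Suc k) - xt0 - Bop (uhat (Suc k)) = (1 / n) *\<^sub>R (\<Sum>i=0..k. p i)"
    unfolding uhat' xhat' Bop p_def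
    by (subst endpoint_op_scaleR_sum[OF \<open>transition_matrix \<theta> Ax Vx\<close> \<open>continuous_on {0..\<theta>} Ax\<close> \<open>0 < \<theta>\<close> \<open>continuous_on {0..\<theta>} B\<close>])
       (simp_all add: L2 sum_subtractf scaleR_diff_right const del: sum_constant)
  have what: "Cop (vhat (Suc k)) + yt0 - yhat (Suc k) = (1 / n) *\<^sub>R (\<Sum>i=0..k. w i)"
    unfolding vhat' yhat' Cop w_def
    by (subst endpoint_op_scaleR_sum[OF \<open>transition_matrix \<theta> Ay Vy\<close> \<open>continuous_on {0..\<theta>} Ay\<close> \<open>0 < \<theta>\<close> \<open>continuous_on {0..\<theta>} C\<close>])
       (simp_all add: L2 sum_subtractf sum.distrib scaleR_diff_right scaleR_add_right const del: sum_constant)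

  \<comment> \<open>Sign of the regret terms at the conjugate saddle point\<close>
  have star: "0 \<le> g i \<bullet> (z i - (lamstar, mustar))" for i
  proof -
    have val: "\<exists>a b a' b'. saddle_point (f1 l m) UU VV a b \<and> saddle_point (f2 l m) X Y a' b' \<and>
        \<psi> l m = ereal (f1 l m a b + f2 l m a' b' - m \<bullet> xt0 + l \<bullet> yt0)" for l m
    proof -
      obtain a b a' b' where "saddle_point (f1 l m) UU VV a b" "saddle_point (f2 l m) X Y a' b'"
        using f1_solvable f2_solvable by blast
      then show ?thesis unfolding \<psi> \<psi>1 \<psi>2 by (auto simp: minmax_eq_saddle_value intro!: exI)
    qed
    \<comment> \<open>Both sides are compared with the saddle value of \<psi>. It remains to bound
      their difference by the regret term, passing through \<psi> at
      \<open>(lam i, mu i)\<close>.\<close>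
    have \<psi>_i: "\<psi> lamstar (mu i) \<le> \<psi> (lam i) mustar"
      using conj_saddle unfolding saddle_point_def by (meson UNIV_I order_trans)
    obtain a b a' b' where 1: "saddle_point (f1 lamstar (mu i)) UU VV a b"
        "saddle_point (f2 lamstar (mu i)) X Y a' b'"
        "\<psi> lamstar (mu i) = ereal (f1 lamstar (mu i) a b + f2 lamstar (mu i) a' b' - mu i \<bullet> xt0 + lamstar \<bullet> yt0)"
      using val by blast
    obtain c e c' e' where 2: "saddle_point (f1 (lam i) mustar) UU VV c e"
        "saddle_point (f2 (lam i) mustar) X Y c' e'"
        "\<psi> (lam i) mustar = ereal (f1 (lam i) mustar c e + f2 (lam i) mustar c' e' - mustar \<bullet> xt0 + lam i \<bullet> yt0)"
      using val by blast
    have "f1 lamstar (mu i) a b + f2 lamstar (mu i) a' b' - mu i \<bullet> xt0 + lamstar \<bullet> yt0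
      \<le> f1 (lam i) mustar c e + f2 (lam i) mustar c' e' - mustar \<bullet> xt0 + lam i \<bullet> yt0"
      using \<psi>_i unfolding 1(3) 2(3) by simp
    \<comment> \<open>Only one multiplier changes at a time: the first two estimates change
      \<lambda> at fixed \<open>mu i\<close>, the last two change \<mu> at fixed
      \<open>lam i\<close>. Hence only the components of the i-th subproblem solutions appear in the
      corrections.\<close>
    moreover have "f1 (lam i) (mu i) (u i) (v i) \<le> f1 lamstar (mu i) a b + (lam i - lamstar) \<bullet> Cop (v i)"
      using saddle_value_le[OF uv[rule_format, of i] 1(1)] unfolding f1 by (simp add: inner_diff_left)
    moreover have "f2 (lam i) (mu i) (x i) (y i) \<le> f2 lamstar (mu i) a' b' - (lam i - lamstar) \<bullet> y i"
      using saddle_value_le[OF xy[rule_format, of i] 1(2)] unfolding f2 by (simp add: inner_diff_left)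
    moreover have "f1 (lam i) mustar c e \<le> f1 (lam i) (mu i) (u i) (v i) + (mu i - mustar) \<bullet> Bop (u i)"
      using saddle_value_le[OF 2(1) uv[rule_format, of i]] unfolding f1 by (simp add: inner_diff_left)
    moreover have "f2 (lam i) mustar c' e' \<le> f2 (lam i) (mu i) (x i) (y i) - (mu i - mustar) \<bullet> x i"
      using saddle_value_le[OF 2(2) xy[rule_format, of i]] unfolding f2 by (simp add: inner_diff_left)
    ultimately have "0 \<le> (lam i - lamstar) \<bullet> w i - (mu i - mustar) \<bullet> p i"
      unfolding w_def p_def by (simp add: inner_simps)
    then show ?thesis unfolding g' z_def by (simp add: inner_commute)
  qed

  \<comment> \<open>Residual estimates\<close>
  have N0: "Nlam 0 = 0" "Nmu 0 = 0" and Nsc: "\<And>c l. Nlam (c *\<^sub>R l) = \<bar>c\<bar> * Nlam l" "\<And>c m. Nmu (c *\<^sub>R m) = \<bar>c\<bar> * Nmu m"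
    using Nlam Nmu unfolding is_norm_def by auto
  have lamstar: "lamstar + c *\<^sub>R l \<in> A" if "\<bar>c\<bar> \<le> r / sqrt (\<kappa> * \<sigma>lam)" "Nlam l \<le> 1" for c l
  proof -
    have "\<bar>c\<bar> * Nlam l \<le> r / sqrt (\<kappa> * \<sigma>lam)"
      using that Nlam mult_left_le[of "Nlam l" "\<bar>c\<bar>"] unfolding is_norm_def by simp
    then show ?thesis using subsetD[OF ball_lam, of "lamstar + c *\<^sub>R l"] unfolding A_def by (simp add: Nsc)
  qed
  have mustar: "mustar + c *\<^sub>R m \<in> M" if "\<bar>c\<bar> \<le> r / sqrt ((1 - \<kappa>) * \<sigma>mu)" "Nmu m \<le> 1" for c m
  proof -
    have "\<bar>c\<bar> * Nmu m \<le> r / sqrt ((1 - \<kappa>) * \<sigma>mu)"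
      using that Nmu mult_left_le[of "Nmu m" "\<bar>c\<bar>"] unfolding is_norm_def by simp
    then show ?thesis using subsetD[OF ball_mu, of "mustar + c *\<^sub>R m"] unfolding M_def by (simp add: Nsc)
  qed
  have star_gap: "- (\<Sum>i=0..k. w i) \<bullet> l + (\<Sum>i=0..k. p i) \<bullet> m \<le> E"
    if "lamstar + l \<in> A" "mustar + m \<in> M" for l m
  proof -
    have "(\<Sum>i=0..k. g i \<bullet> (z i - (lamstar + l, mustar + m)))
        = (\<Sum>i=0..k. g i \<bullet> (z i - (lamstar, mustar))) + (- (\<Sum>i=0..k. w i) \<bullet> l + (\<Sum>i=0..k. p i) \<bullet> m)"
      unfolding z_def g' by (simp add: inner_sum_left sum_negf sum_subtractf sum.distrib inner_simps)
    moreover have "0 \<le> (\<Sum>i=0..k. g i \<bullet> (z i - (lamstar, mustar)))" by (intro sum_nonneg star)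
    ultimately show ?thesis using gap[OF that] by linarith
  qed
  have mu_residual: "dual_norm Nmu (xt0 + Bop (uhat (Suc k)) - xhat (Suc k)) \<le> sqrt \<sigma>mu / (r * n) * E"
  proof -
    have "dual_norm Nmu ((1 / n) *\<^sub>R - (\<Sum>i=0..k. p i)) \<le> sqrt \<sigma>mu / (r * n) * E"
    proof (rule dual_norm_scaled_le[OF Nmu])
      fix m assume m: "Nmu m \<le> 1"
      let ?c = "r / sqrt ((1 - \<kappa>) * \<sigma>mu)"
      \<comment> \<open>Only \<mu> is displaced. The minus sign reflects that \<open>p\<close> is
        the negative of the wanted residual; in the \<lambda> case it comes from the minus sign in
        \<open>star_gap\<close>.\<close>
      have "- (\<Sum>i=0..k. w i) \<bullet> 0 + (\<Sum>i=0..k. p i) \<bullet> ((- ?c) *\<^sub>R m) \<le> E"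
        using lamstar[of 0 0] mustar[of "- ?c" m] m \<open>0 < r\<close> \<kappa> N0 by (intro star_gap) auto
      then show "?c * (- (\<Sum>i=0..k. p i) \<bullet> m) \<le> E" by simp
    qed (use \<sigma> \<open>0 < r\<close> \<open>0 < n\<close> \<open>0 \<le> E\<close> \<open>0 < \<kappa>\<close> \<open>\<kappa> < 1\<close> in auto)
    moreover have "xt0 + Bop (uhat (Suc k)) - xhat (Suc k) = (1 / n) *\<^sub>R - (\<Sum>i=0..k. p i)"
      using phat by (simp add: algebra_simps)
    ultimately show ?thesis by simp
  qed
  have lam_residual: "dual_norm Nlam (yt0 + Cop (vhat (Suc k)) - yhat (Suc k)) \<le> sqrt \<sigma>lam / (r * n) * E"
  proof -
    have "dual_norm Nlam ((1 / n) *\<^sub>R (\<Sum>i=0..k. w i)) \<le> sqrt \<sigma>lam / (r * n) * E"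
    proof (rule dual_norm_scaled_le[OF Nlam])
      fix l assume l: "Nlam l \<le> 1"
      let ?c = "r / sqrt (\<kappa> * \<sigma>lam)"
      have "- (\<Sum>i=0..k. w i) \<bullet> ((- ?c) *\<^sub>R l) + (\<Sum>i=0..k. p i) \<bullet> 0 \<le> E"
        using mustar[of 0 0] lamstar[of "- ?c" l] l \<open>0 < r\<close> \<kappa> N0 by (intro star_gap) auto
      then show "?c * ((\<Sum>i=0..k. w i) \<bullet> l) \<le> E" by simp
    qed (use \<sigma> \<open>0 < r\<close> \<open>0 < n\<close> \<open>0 \<le> E\<close> \<open>0 < \<kappa>\<close> \<open>\<kappa> < 1\<close> in auto)
    then show ?thesis unfolding what[symmetric] by (simp add: add.commute)
  qed

  \<comment> \<open>Gap of the averaged points\<close>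
  let ?l0 = "(1 / n) *\<^sub>R (\<Sum>i=0..k. lam i)" and ?m0 = "(1 / n) *\<^sub>R (\<Sum>i=0..k. mu i)"
  have mean_mem: "?l0 \<in> A" "?m0 \<in> M"
    unfolding n_def A_def M_def
    by (rule convex_average; use Dlam Dmu \<sigma> sc in \<open>auto intro: strongly_convex_imp_convex_sublevel\<close>)+
  \<comment> \<open>The pair \<open>v', y'\<close> is the one maximized in \<xi>, and
    \<open>u', x'\<close> the one minimized in \<eta>. The mean \<open>?l0\<close> is the choice in
    the outer minimum on the left, \<open>?m0\<close> the choice in the inner maximum on the
    right.\<close>
  have ineq: "F (uhat (Suc k)) v' + \<Phi> (xhat (Suc k)) y' + m \<bullet> (xhat (Suc k) - xt0 - Bop (uhat (Suc k)))
        + ?l0 \<bullet> (Cop v' + yt0 - y')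
      \<le> F u' (vhat (Suc k)) + \<Phi> x' (yhat (Suc k)) + ?m0 \<bullet> (x' - xt0 - Bop u')
        + l \<bullet> (Cop (vhat (Suc k)) + yt0 - yhat (Suc k)) + E / n"
    if in': "u' \<in> UU" "v' \<in> VV" "x' \<in> X" "y' \<in> Y" and lm: "l \<in> A" "m \<in> M" for u' v' x' y' l m
  proof -
    define W where "W = Cop v' + yt0 - y'"
    define R where "R = x' - xt0 - Bop u'"
    have J: "F (uhat (Suc k)) v' \<le> (\<Sum>i=0..k. F (u i) v') / n"
      using functional_convex_on_average[of UU "\<lambda>u. F u v'" u k] A2(1) in'(2) cc(1) mem(1)
      unfolding uhat' n_def by blast
    have "- F u' (vhat (Suc k)) \<le> (\<Sum>i=0..k. - F u' (v i)) / n"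
      using functional_convex_on_average[of VV "\<lambda>v. - F u' v" v k] A2(2) in'(1) cc(2) mem(2)
      unfolding vhat' n_def functional_concave_on_def by blast
    then have J': "(\<Sum>i=0..k. F u' (v i)) / n \<le> F u' (vhat (Suc k))" by (simp add: sum_negf)
    have K: "\<Phi> (xhat (Suc k)) y' \<le> (\<Sum>i=0..k. \<Phi> (x i) y') / n"
      using convex_on_average[of X "\<lambda>x. \<Phi> x y'" x k] A2(3) in'(4) mem(3) unfolding xhat' n_def by blast
    have "- \<Phi> x' (yhat (Suc k)) \<le> (\<Sum>i=0..k. - \<Phi> x' (y i)) / n"
      using convex_on_average[of Y "\<lambda>y. - \<Phi> x' y" y k] A2(4) in'(3) mem(4)
      unfolding yhat' n_def concave_on_def by blast
    then have K': "(\<Sum>i=0..k. \<Phi> x' (y i)) / n \<le> \<Phi> x' (yhat (Suc k))" by (simp add: sum_negf)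
    \<comment> \<open>Pass through the saddle value of each subproblem, from
      \<open>(u i, v')\<close> to \<open>(u', v i)\<close> and from \<open>(x i, y')\<close> to
      \<open>(x', y i)\<close>. Replacing \<open>mu i\<close> by \<open>m\<close> against
      \<open>p i\<close> and \<open>lam i\<close> by \<open>l\<close> against \<open>w i\<close>
      costs exactly the regret term.\<close>
    have term_le: "F (u i) v' + \<Phi> (x i) y' + m \<bullet> p i + lam i \<bullet> W
        \<le> F u' (v i) + \<Phi> x' (y i) + mu i \<bullet> R + l \<bullet> w i + g i \<bullet> (z i - (l, m))" for i
    proof -
      have "f1 (lam i) (mu i) (u i) v' \<le> f1 (lam i) (mu i) u' (v i)"
        "f2 (lam i) (mu i) (x i) y' \<le> f2 (lam i) (mu i) x' (y i)"
        using uv xy in' unfolding saddle_point_def by (meson order_trans)+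
      then show ?thesis unfolding f1 f2 W_def R_def g' z_def w_def p_def
        by (simp add: inner_simps inner_commute)
    qed
    \<comment> \<open>Averaging is exact for the inner products; Jensen's inequality handles the
      remaining terms in the required direction on each side.\<close>
    have "F (uhat (Suc k)) v' + \<Phi> (xhat (Suc k)) y' + m \<bullet> ((1 / n) *\<^sub>R (\<Sum>i=0..k. p i)) + ?l0 \<bullet> W
      \<le> (\<Sum>i=0..k. F (u i) v' + \<Phi> (x i) y' + m \<bullet> p i + lam i \<bullet> W) / n"
      using J K by (simp add: sum.distrib add_divide_distrib inner_sum_left inner_sum_right)
    also have "\<dots> \<le> (\<Sum>i=0..k. F u' (v i) + \<Phi> x' (y i) + mu i \<bullet> R + l \<bullet> w i + g i \<bullet> (z i - (l, m))) / n"
      using \<open>0 < n\<close> by (intro divide_right_mono sum_mono term_le) simp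
    also have "\<dots> = (\<Sum>i=0..k. F u' (v i)) / n + (\<Sum>i=0..k. \<Phi> x' (y i)) / n + ?m0 \<bullet> R
        + l \<bullet> ((1 / n) *\<^sub>R (\<Sum>i=0..k. w i)) + (\<Sum>i=0..k. g i \<bullet> (z i - (l, m))) / n"
      by (simp add: sum.distrib add_divide_distrib inner_sum_left inner_sum_right del: inner_diff_right)
    also have "\<dots> \<le> F u' (vhat (Suc k)) + \<Phi> x' (yhat (Suc k)) + ?m0 \<bullet> R
        + l \<bullet> ((1 / n) *\<^sub>R (\<Sum>i=0..k. w i)) + E / n"
      using J' K' gap[OF lm] \<open>0 < n\<close> by (intro add_mono order_refl divide_right_mono) auto
    finally show ?thesis unfolding phat what W_def R_def .
  qed
  have "\<xi> (uhat (Suc k)) (xhat (Suc k)) - \<eta> (vhat (Suc k)) (yhat (Suc k)) \<le> ereal (E / n)"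
    unfolding \<xi> \<eta> \<phi> case_prod_beta A_def[symmetric] M_def[symmetric]
    by (rule SUP_minmax_diff_INF_minmax_le[OF _ mean_mem]) (use ineq mem in auto)
  then show ?thesis
    using mu_residual lam_residual unfolding E_def n_def by (simp add: field_simps del: beta_hat.simps)
qed

end
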